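(* The following assertions hold: (i) If $\alpha\in\left(0,\frac35\right]$, then $E_{\alpha,1}(\mathrm{i}t)\ne0$ for all $t\in\mathbb{R}$. (ii) If $\alpha\in\left(\frac35,1\right)$, there exists at most a finite number of $t\in\mathbb{R}$ such that $E_{\alpha,1}(\mathrm{i}t)=0$.
   Context: $E_{\alpha,\beta}(z)=\sum_{n=0}^\infty\frac{z^n}{\Gamma(\alpha n+\beta)}$, $z\in\mathbb{C}$, is the Mittag-Leffler function ($\alpha>0$, $\beta\in\mathbb{R}$), and $\mathrm{i}$ is the imaginary unit. *)

theory Defs
  imports "HOL-Analysis.Analysis"
begin

text \<open>
  Where \<open>\<alpha> n + \<beta>\<close> is a pole of the Gamma function, the library has \<open>Gamma = 0\<close>, so that the
  term \<open>z ^ n / 0\<close> is \<open>0\<close>, in agreement with the usual convention that \<open>1 / \<Gamma>\<close> vanishes there.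
  The series converges for all \<open>z\<close> when \<open>\<alpha> > 0\<close>; for other \<open>\<alpha>\<close> the value is not meaningful.
\<close>

definition mittag_leffler :: "real \<Rightarrow> real \<Rightarrow> complex \<Rightarrow> complex" where
  "mittag_leffler \<alpha> \<beta> z = (\<Sum>n. z ^ n / complex_of_real (Gamma (\<alpha> * real n + \<beta>)))"

end

theory Submission
  imports Defs "HOL-Complex_Analysis.Complex_Analysis"
begin

text \<open>
  On the positive real axis put \<open>f y = Im (E\<^sub>\<alpha> (\<i> y\<^sup>\<alpha>))\<close>. Its Laplace transform is
  \<open>s\<^sup>\<alpha>\<^sup>-\<^sup>1 / (s\<^sup>2\<^sup>\<alpha> + 1)\<close>. Cutting the plane along the negative axis, the residue theorem (in the
  variable \<open>log s\<close>, on rectangles with \<open>\<bar>Im\<bar> \<le> \<pi>\<close>) writes this transform as a Stieltjes integral plus,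
  when \<open>\<alpha> > 1/2\<close>, the contribution of the poles \<open>exp (\<plusminus>\<i>\<theta>)\<close> with \<open>\<theta> = \<pi>/(2\<alpha>)\<close>. By uniqueness of Laplace
  transforms, for \<open>\<alpha> \<noteq> 1/2\<close>,
  \<open>f y = [\<alpha> > 1/2] exp (y cos \<theta>) sin (y sin \<theta>) / \<alpha> + sin (\<pi>\<alpha>)/(2\<pi>) \<integral> (exp (- y exp (- x)) - exp (- y exp x)) w x dx\<close>
  over \<open>x > 0\<close>, where \<open>w x = sinh (\<alpha>x) / (sinh\<^sup>2 (\<alpha>x) + cos\<^sup>2 (\<pi>\<alpha>)) > 0\<close>. Folding the integral by \<open>x \<mapsto> - x\<close>
  is what makes its integrand positive. The integral decays only like a power of \<open>y\<close>, whereas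
  the pole term decays exponentially as \<open>cos \<theta> < 0\<close>; so \<open>f > 0\<close> for large \<open>y\<close>, and the zeros on the imaginary
  axis are bounded. For \<open>\<alpha> \<le> 3/5\<close> we have \<open>\<theta> \<ge> 5\<pi>/6\<close>, so the pole term is nonnegative up to
  \<open>y = \<pi> / sin \<theta> \<ge> 2\<pi>\<close> and afterwards too small to compensate the integral. For \<open>\<alpha> = 1/2\<close> the
  poles lie on the cut, but there \<open>Re (E\<^sub>\<alpha> (\<i> t)) = exp (- t\<^sup>2)\<close>.
\<close>

subsection \<open>The Mittag-Leffler series\<close>

text \<open>Keep only the part \<open>t \<ge> A\<close> of Euler's integral. There
  \<open>t powr z\<close> is at least \<open>A powr z\<close>, and the remaining exponential has
  integral \<open>exp (- A)\<close>.\<close>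

lemma powr_exp_le_Gamma:
  fixes A z :: real
  assumes A: "A \<ge> 0" and z: "z \<ge> 0"
  shows "A powr z * exp (- A) \<le> Gamma (z + 1)"
proof -
  have 1: "((\<lambda>t. t powr z / exp t) has_integral Gamma (z + 1)) {0..}"
    using Gamma_integral_real[of "z + 1"] z by simp
  have 2: "((\<lambda>t. A powr z * exp (- 1 * t)) has_integral A powr z * (exp (- 1 * A) / 1)) {A..}"
    by (intro has_integral_mult_right has_integral_exp_minus_to_infinity) simp
  then have 3: "((\<lambda>t. if t \<in> {A..} then A powr z * exp (- 1 * t) else 0)
      has_integral A powr z * exp (- A)) {0..}"
    using A by (subst has_integral_restrict) auto
  show ?thesis
  proof (rule has_integral_le[OF 3 1])
    fix t :: real assume "t \<in> {0..}"
    then show "(if t \<in> {A..} then A powr z * exp (- 1 * t) else 0) \<le> t powr z / exp t"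
      using A z powr_mono2[of z A t]
      by (auto simp: exp_minus field_simps intro!: divide_right_mono mult_right_mono)
  qed
qed

text \<open>The parameter \<open>A\<close> of the previous lemma is chosen so that \<open>A\<^sup>\<alpha> = 2x\<close>.\<close>

lemma mittag_leffler_term_le:
  fixes \<alpha> x :: real
  assumes "\<alpha> > 0" and "x \<ge> 0"
  shows "x ^ n / Gamma (\<alpha> * real n + 1) \<le> exp ((2 * x) powr (1/\<alpha>)) * (1/2) ^ n"
proof (cases "x = 0")
  case True
  then show ?thesis by (cases n) auto
next
  case False
  define A where "A = (2 * x) powr (1/\<alpha>)"
  have x: "x > 0" using False assms by simp
  have Ap: "A powr (\<alpha> * real n) = (2 * x) ^ n"
    using x assms by (simp add: A_def powr_powr powr_realpow)
  have G: "(2 * x) ^ n * exp (- A) \<le> Gamma (\<alpha> * real n + 1)"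
  proof -
    have "0 \<le> \<alpha> * real n" using assms by simp
    from powr_exp_le_Gamma[OF _ this, of A] show ?thesis
      unfolding Ap by (simp add: A_def)
  qed
  have "x ^ n / Gamma (\<alpha> * real n + 1) \<le> x ^ n / ((2 * x) ^ n * exp (- A))"
    using x less_le_trans[OF _ G] by (intro divide_left_mono G mult_pos_pos) auto
  also have "\<dots> = exp A * (1/2) ^ n"
    using x by (simp add: exp_minus field_simps)
  finally show ?thesis by (simp add: A_def)
qed

text \<open>Both claims come from one geometric majorant. The growth bound matters later: at
  \<open>z = \<i> * y powr \<alpha>\<close> the exponent is linear in \<open>y\<close>, which is the
  exponential type that uniqueness of Laplace transforms requires.\<close>

lemma
  fixes \<alpha> :: real and z :: complex
  assumes \<alpha>: "\<alpha> > 0"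
  shows summable_mittag_leffler:
      "summable (\<lambda>n. norm (z ^ n / complex_of_real (Gamma (\<alpha> * real n + 1))))"
    and norm_mittag_leffler_le:
      "norm (mittag_leffler \<alpha> 1 z) \<le> 2 * exp ((2 * norm z) powr (1/\<alpha>))"
proof -
  let ?t = "\<lambda>n. z ^ n / complex_of_real (Gamma (\<alpha> * real n + 1))"
  let ?B = "exp ((2 * norm z) powr (1/\<alpha>))"
  have le: "norm (?t n) \<le> ?B * (1/2) ^ n" for n
  proof -
    have "Gamma (\<alpha> * real n + 1) > 0"
      using \<alpha> by (intro Gamma_real_pos add_nonneg_pos) auto
    then show ?thesis
      using mittag_leffler_term_le[OF \<alpha>, of "norm z" n] by (simp add: norm_divide norm_power)
  qed
  have g: "(\<lambda>n. ?B * (1/2) ^ n) sums (?B * 2)"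
    using sums_mult[OF geometric_sums[of "1/2::real"], of ?B] by simp
  show s: "summable (\<lambda>n. norm (?t n))"
    by (rule summable_comparison_test'[of _ 0, OF sums_summable[OF g]]) (use le in auto)
  have "norm (\<Sum>n. ?t n) \<le> (\<Sum>n. norm (?t n))"
    by (rule summable_norm[OF s])
  also have "\<dots> \<le> ?B * 2"
    using suminf_le[OF _ s sums_summable[OF g]] le sums_unique[OF g] by auto
  finally show "norm (mittag_leffler \<alpha> 1 z) \<le> 2 * ?B"
    by (simp add: mittag_leffler_def mult.commute)
qed

lemma mittag_leffler_sums:
  assumes "\<alpha> > 0"
  shows "(\<lambda>n. z ^ n / complex_of_real (Gamma (\<alpha> * real n + 1))) sums mittag_leffler \<alpha> 1 z"
  unfolding mittag_leffler_def
  by (rule summable_sums[OF summable_norm_cancel[OF summable_mittag_leffler[OF assms]]])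

lemma mittag_leffler_0:
  assumes "\<alpha> > 0"
  shows "mittag_leffler \<alpha> 1 0 = 1"
proof (rule sums_unique2[OF mittag_leffler_sums[OF assms]])
  show "(\<lambda>n. 0 ^ n / complex_of_real (Gamma (\<alpha> * real n + 1))) sums 1"
    using powser_sums_zero[of "\<lambda>n. 1 / complex_of_real (Gamma (\<alpha> * real n + 1))"] by simp
qed

lemma holomorphic_mittag_leffler:
  assumes "\<alpha> > 0"
  shows "mittag_leffler \<alpha> 1 holomorphic_on UNIV"
proof -
  have "mittag_leffler \<alpha> 1 holomorphic_on ball 0 r" for r
    by (rule power_series_holomorphic[where a = "\<lambda>n. 1 / complex_of_real (Gamma (\<alpha> * real n + 1))"])
       (use mittag_leffler_sums[OF assms] in simp)
  then have "mittag_leffler \<alpha> 1 field_differentiable at z" for z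
    by (rule holomorphic_on_imp_differentiable_at[of _ "ball 0 (norm z + 1)"]) auto
  then show ?thesis
    by (simp add: holomorphic_on_def)
qed

lemma mittag_leffler_cnj:
  assumes "\<alpha> > 0"
  shows "mittag_leffler \<alpha> 1 (cnj z) = cnj (mittag_leffler \<alpha> 1 z)"
proof (rule sums_unique2[OF mittag_leffler_sums[OF assms]])
  show "(\<lambda>n. cnj z ^ n / complex_of_real (Gamma (\<alpha> * real n + 1))) sums cnj (mittag_leffler \<alpha> 1 z)"
    using bounded_linear.sums[OF bounded_linear_cnj mittag_leffler_sums[OF assms, of z]] by simp
qed

text \<open>This lets the transform of the pole term be read off from the general Mittag-Leffler
  transform at order 1.\<close>

lemma mittag_leffler_1: "mittag_leffler 1 1 z = exp z"
proof -
  have "z ^ n / complex_of_real (Gamma (1 * real n + 1)) = z ^ n /\<^sub>R fact n" for n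
    using Gamma_fact[of n, where 'a = real] by (simp add: add.commute divide_inverse scaleR_conv_of_real)
  then show ?thesis
    unfolding mittag_leffler_def exp_def by simp
qed

subsection \<open>Laplace transforms\<close>

text \<open>A single predicate carries both absolute convergence and the value, so the closure rules
  for \<open>has_bochner_integral\<close> transfer directly. The parameter \<open>s\<close> is real,
  which suffices for uniqueness.\<close>

definition has_laplace :: "(real \<Rightarrow> 'a::{banach,second_countable_topology}) \<Rightarrow> real \<Rightarrow> 'a \<Rightarrow> bool" where
  "has_laplace u s L \<longleftrightarrow>
     has_bochner_integral lborel (\<lambda>y. indicator {0<..} y *\<^sub>R exp (- (s * y)) *\<^sub>R u y) L"

text \<open>Substitute \<open>t = s * y\<close> in Euler's integral for
  \<open>Gamma (c + 1)\<close>.\<close>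

lemma has_laplace_powr:
  assumes c: "c > -1" and s: "s > 0"
  shows "has_laplace (\<lambda>y. y powr c) s (Gamma (c + 1) / s powr (c + 1))"
proof -
  let ?g = "\<lambda>t::real. indicator {0<..} t * exp (- t) * t powr c"
  have "(\<integral>\<^sup>+ t. ennreal (?g t) \<partial>lborel) = ennreal (Gamma (c + 1))"
  proof -
    have "(\<lambda>t. ennreal (indicator {0..} t * t powr (c + 1 - 1) / exp t)) = (\<lambda>t. ennreal (?g t))"
      by (auto simp: exp_minus field_simps indicator_def)
    then show ?thesis
      using Gamma_conv_nn_integral_real[of "c + 1"] c by simp
  qed
  then have g: "has_bochner_integral lborel ?g (Gamma (c + 1))"
    using c by (intro has_bochner_integral_nn_integral) (auto intro!: less_imp_le Gamma_real_pos)
  have "has_bochner_integral lborel (\<lambda>x. ?g (0 + s * x)) (Gamma (c + 1) /\<^sub>R \<bar>s\<bar>)"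
    using s g by (subst (asm) lborel_has_bochner_integral_real_affine_iff[of s _ _ 0]) auto
  then have "has_bochner_integral lborel (\<lambda>x. ?g (0 + s * x) / s powr c) (Gamma (c + 1) /\<^sub>R \<bar>s\<bar> / s powr c)"
    by (intro has_bochner_integral_divide_zero) auto
  moreover have "?g (0 + s * x) / s powr c = indicator {0<..} x *\<^sub>R exp (- (s * x)) *\<^sub>R x powr c" for x
    using s by (auto simp: indicator_def powr_mult zero_less_mult_iff)
  moreover have "Gamma (c + 1) /\<^sub>R \<bar>s\<bar> / s powr c = Gamma (c + 1) / s powr (c + 1)"
    using s by (simp add: powr_add field_simps)
  ultimately show ?thesis
    by (simp add: has_laplace_def)
qed

text \<open>Integrate termwise. The Gamma factor of each monomial's transform cancels the one in the
  series, leaving \<open>?q ^ n / s\<close>. The integrals of the norms form a geometric series of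
  ratio \<open>norm ?q < 1\<close>, which justifies the interchange.\<close>

lemma has_laplace_mittag_leffler:
  fixes \<alpha> s :: real and w :: complex
  assumes \<alpha>: "\<alpha> > 0" and s: "s > 0" and w: "norm w < s powr \<alpha>"
  shows "has_laplace (\<lambda>y. mittag_leffler \<alpha> 1 (w * of_real (y powr \<alpha>))) s
     (1 / (of_real s * (1 - w / of_real (s powr \<alpha>))))"
proof -
  let ?q = "w / complex_of_real (s powr \<alpha>)"
  let ?f = "\<lambda>n y. indicator {0<..} y *\<^sub>R exp (- (s * y)) *\<^sub>R
     ((w * complex_of_real (y powr \<alpha>)) ^ n / complex_of_real (Gamma (\<alpha> * real n + 1)))"
  have q: "norm ?q < 1"
    using w s by (simp add: norm_divide)
  have G: "Gamma (\<alpha> * real n + 1) > 0" for n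
    using \<alpha> by (intro Gamma_real_pos add_nonneg_pos) auto
  let ?h = "\<lambda>n y. indicator {0<..} y *\<^sub>R exp (- (s * y)) *\<^sub>R (y powr (\<alpha> * real n))"
  have h: "has_bochner_integral lborel (?h n) (Gamma (\<alpha> * real n + 1) / s powr (\<alpha> * real n + 1))" for n
    using has_laplace_powr[of "\<alpha> * real n" s] \<alpha> s unfolding has_laplace_def
    by (simp add: add.commute less_le_trans[of "-1" 0])
  have sp: "s powr (\<alpha> * real n + 1) = s * (s powr \<alpha>) ^ n" for n
    using s by (simp add: powr_add powr_powr[symmetric] powr_realpow)
  have hf: "?f n y = of_real (?h n y) * (w ^ n / complex_of_real (Gamma (\<alpha> * real n + 1)))" for n y
    by (auto simp: indicator_def power_mult_distrib powr_powr[symmetric] powr_realpow scaleR_conv_of_real)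
  have f: "has_bochner_integral lborel (?f n) (?q ^ n / of_real s)" for n
  proof -
    have "has_bochner_integral lborel (\<lambda>y. complex_of_real (?h n y) * (w ^ n / complex_of_real (Gamma (\<alpha> * real n + 1))))
       (complex_of_real (Gamma (\<alpha> * real n + 1) / s powr (\<alpha> * real n + 1)) * (w ^ n / complex_of_real (Gamma (\<alpha> * real n + 1))))"
      by (intro has_bochner_integral_mult_left has_bochner_integral_of_real h) 
    moreover have "complex_of_real (Gamma (\<alpha> * real n + 1) / s powr (\<alpha> * real n + 1)) * (w ^ n / complex_of_real (Gamma (\<alpha> * real n + 1)))
       = ?q ^ n / of_real s"
      unfolding sp using G[of n] s by (simp add: power_divide divide_simps)
    ultimately show ?thesis
      unfolding hf by simp
  qed
  have nf: "norm (?f n y) = ?h n y * (norm w ^ n / Gamma (\<alpha> * real n + 1))" for n y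
    unfolding hf using G[of n] by (simp add: norm_mult norm_divide norm_power)
  have inf: "(\<integral>y. norm (?f n y) \<partial>lborel) = norm ?q ^ n / s" for n
  proof -
    have "(\<integral>y. norm (?f n y) \<partial>lborel)
        = Gamma (\<alpha> * real n + 1) / s powr (\<alpha> * real n + 1) * (norm w ^ n / Gamma (\<alpha> * real n + 1))"
      unfolding nf
      by (intro has_bochner_integral_integral_eq has_bochner_integral_mult_left h)
    also have "\<dots> = norm ?q ^ n / s"
      unfolding sp using G[of n] s by (simp add: norm_divide power_divide divide_simps)
    finally show ?thesis .
  qed
  have sm: "AE y in lborel. summable (\<lambda>n. norm (?f n y))"
  proof (rule AE_I2)
    fix y :: real
    show "summable (\<lambda>n. norm (?f n y))"
      using summable_mult[OF summable_mittag_leffler[OF \<alpha>, of "w * complex_of_real (y powr \<alpha>)"], of "norm (indicator {0<..} y *\<^sub>R exp (- (s * y)))"]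
      by (simp add: mult.assoc)
  qed
  have sn: "summable (\<lambda>n. \<integral>y. norm (?f n y) \<partial>lborel)"
    unfolding inf using q by (intro summable_divide summable_geometric) simp
  have fint: "integrable lborel (?f n)" and fval: "integral\<^sup>L lborel (?f n) = ?q ^ n / of_real s" for n
    using f[of n] by (auto simp: has_bochner_integral_iff)
  have S: "(\<Sum>n. ?f n y) = indicator {0<..} y *\<^sub>R exp (- (s * y)) *\<^sub>R mittag_leffler \<alpha> 1 (w * of_real (y powr \<alpha>))" for y
    by (rule sums_unique[OF sums_scaleR_right[OF sums_scaleR_right[OF mittag_leffler_sums[OF \<alpha>]]], symmetric])
  have "integrable lborel (\<lambda>y. \<Sum>n. ?f n y)"
    by (rule integrable_suminf[OF fint sm sn])
  moreover have "(\<integral>y. (\<Sum>n. ?f n y) \<partial>lborel) = 1 / (of_real s * (1 - ?q))"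
  proof -
    have "(\<lambda>n. ?q ^ n / of_real s) sums (\<integral>y. (\<Sum>n. ?f n y) \<partial>lborel)"
      using sums_integral[OF fint sm sn] by (simp only: fval)
    moreover have "(\<lambda>n. ?q ^ n / of_real s) sums (1 / (1 - ?q) / of_real s)"
      using q by (intro sums_divide geometric_sums)
    ultimately show ?thesis
      by (simp add: sums_iff mult.commute)
  qed
  ultimately show ?thesis
    unfolding S has_laplace_def has_bochner_integral_iff by simp
qed

lemma has_laplace_diff:
  "has_laplace u s L \<Longrightarrow> has_laplace v s M \<Longrightarrow> has_laplace (\<lambda>y. u y - v y) s (L - M)"
  unfolding has_laplace_def by (drule (1) has_bochner_integral_diff) (simp add: scaleR_diff_right)

lemma has_laplace_mult:
  fixes c :: real
  shows "has_laplace u s L \<Longrightarrow> has_laplace (\<lambda>y. c * u y) s (c * L)"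
  unfolding has_laplace_def
  using has_bochner_integral_mult_right[of c lborel "\<lambda>y. indicator {0<..} y *\<^sub>R exp (- (s * y)) *\<^sub>R u y" L]
  by (simp add: mult_ac)

lemma has_laplace_Im:
  "has_laplace u s L \<Longrightarrow> has_laplace (\<lambda>y. Im (u y)) s (Im L)"
  unfolding has_laplace_def by (drule has_bochner_integral_Im) (simp add: mult.assoc)

lemma has_laplace_cong:
  assumes "\<And>y. y > 0 \<Longrightarrow> u y = v y"
  shows "has_laplace u s L \<longleftrightarrow> has_laplace v s L"
proof -
  have "(\<lambda>y. indicator {0<..} y *\<^sub>R exp (- (s * y)) *\<^sub>R u y) = (\<lambda>y. indicator {0<..} y *\<^sub>R exp (- (s * y)) *\<^sub>R v y)"
  proof
    fix y :: real
    show "indicator {0<..} y *\<^sub>R exp (- (s * y)) *\<^sub>R u y = indicator {0<..} y *\<^sub>R exp (- (s * y)) *\<^sub>R v y"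
      using assms[of y] by (cases "y > 0") auto
  qed
  then show ?thesis by (simp only: has_laplace_def)
qed

section \<open>Uniqueness of Laplace transforms\<close>

text \<open>
  Only integer translates of \<open>s0\<close> are needed: in the variable \<open>v = exp (- y)\<close> the hypothesis says that
  \<open>u\<close>, damped to a continuous \<open>\<phi>\<close> on \<open>[0, 1]\<close>, is orthogonal to all polynomials.
\<close>

lemma has_laplace_zero_imp_zero:
  fixes u :: "real \<Rightarrow> real"
  assumes cont: "continuous_on {0..} u"
    and bound: "\<And>y. y \<ge> 0 \<Longrightarrow> \<bar>u y\<bar> \<le> C * exp (b * y)"
    and laplace: "\<And>s. s \<ge> s0 \<Longrightarrow> has_laplace u s 0"
    and y: "y > 0"
  shows "u y = 0"
proof -
  \<comment> \<open>Taking \<open>\<sigma> \<ge> s0\<close> makes the hypothesis available at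
    \<open>\<sigma> + 1 + i\<close>. Taking \<open>\<sigma> \<ge> b + 1\<close> makes
    \<open>g\<close> decay like \<open>exp (- y)\<close>, hence
    \<open>\<bar>\<phi> v\<bar> \<le> C * v\<close>, so the value 0 at \<open>v = 0\<close> is the
    continuous one.\<close>
  define \<sigma> where "\<sigma> = max s0 (b + 1)"
  define g where "g = (\<lambda>y. exp (- (\<sigma> * y)) * u y)"
  define \<phi> where "\<phi> = (\<lambda>v::real. if v = 0 then 0 else g (- ln v))"
  have \<phi>_exp: "\<phi> (exp (- y)) = g y" for y
    by (simp add: \<phi>_def)
  have g_cont: "continuous_on {0..} g"
    unfolding g_def by (intro continuous_intros cont)
  have \<phi>_le: "\<bar>\<phi> v\<bar> \<le> C * v" if "v \<in> {0..1}" for v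
  proof (cases "v = 0")
    case False
    then have v: "0 < v" "v \<le> 1" using that by auto
    then have L: "- ln v \<ge> 0" by simp
    have "C \<ge> 0" using bound[of 0] by simp
    have "\<bar>\<phi> v\<bar> \<le> exp (\<sigma> * ln v) * (C * exp (b * (- ln v)))"
      using False bound[OF L] by (auto simp: \<phi>_def g_def abs_mult intro!: mult_left_mono)
    also have "\<dots> = C * exp ((\<sigma> - b) * ln v)"
      by (simp add: exp_add[symmetric] algebra_simps)
    also have "(\<sigma> - b) * ln v \<le> 1 * ln v"
      using L by (intro mult_right_mono_neg) (auto simp: \<sigma>_def)
    then have "C * exp ((\<sigma> - b) * ln v) \<le> C * exp (1 * ln v)"
      using \<open>C \<ge> 0\<close> by (intro mult_left_mono) auto
    finally show ?thesis using v by simp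
  qed (simp add: \<phi>_def)
  have \<phi>_cont: "continuous_on {0..1} \<phi>"
    unfolding continuous_on_eq_continuous_within
  proof
    fix v :: real assume v: "v \<in> {0..1}"
    show "continuous (at v within {0..1}) \<phi>"
    proof (cases "v = 0")
      case True
      have lim: "((\<lambda>v. C * v) \<longlongrightarrow> 0) (at 0 within {0..1})"
        by (auto intro!: tendsto_eq_intros)
      have "(\<phi> \<longlongrightarrow> 0) (at 0 within {0..1})"
      proof (rule Lim_null_comparison[OF _ lim])
        show "\<forall>\<^sub>F x in at 0 within {0..1}. norm (\<phi> x) \<le> C * x"
          unfolding eventually_at_filter
          by (rule always_eventually) (use \<phi>_le in auto)
      qed
      then show ?thesis
        by (simp add: continuous_within True \<phi>_def)
    next
      case False
      then have v0: "v \<in> {0<..1}" using v by auto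
      have "continuous_on {0<..1} (\<lambda>v. g (- ln v))"
        by (intro continuous_on_compose2[OF g_cont] continuous_intros) auto
      then have "continuous_on {0<..1} \<phi>"
        by (rule continuous_on_eq) (auto simp: \<phi>_def)
      then have "continuous (at v within {0<..1}) \<phi>"
        using v0 by (simp add: continuous_on_eq_continuous_within)
      moreover have "at v within {0..1} = at v within {0<..1}"
        by (rule at_within_nhd[of _ "{0<..}"]) (use v0 in auto)
      ultimately show ?thesis by simp
    qed
  qed
  let ?M = "\<lambda>y. indicator {0<..} y * (exp (- y) * \<bar>g y\<bar>)"
  let ?D = "\<lambda>y. indicator {0<..} y * (exp (- y) * (g y)\<^sup>2)"
  \<comment> \<open>The extra factor \<open>exp (- y)\<close> is the Jacobian of
    \<open>v = exp (- y)\<close>: the integral of \<open>?E i\<close> is the \<open>i\<close>-th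
    moment of \<open>\<phi>\<close> on the unit interval.\<close>
  let ?E = "\<lambda>i y. indicator {0<..} y * (exp (- y) * g y * exp (- y) ^ i)"
  have E: "has_bochner_integral lborel (?E i) 0" for i :: nat
  proof -
    have "has_laplace u (\<sigma> + 1 + real i) 0"
      by (rule laplace) (simp add: \<sigma>_def)
    moreover have "indicator {0<..} y *\<^sub>R exp (- ((\<sigma> + 1 + real i) * y)) *\<^sub>R u y = ?E i y" for y
      by (simp add: g_def exp_of_nat_mult[symmetric] exp_add[symmetric] algebra_simps)
    ultimately show ?thesis
      by (simp only: has_laplace_def)
  qed
  have M: "integrable lborel ?M"
    using integrable_norm[of lborel "?E 0"] E[of 0]
    by (simp add: has_bochner_integral_iff abs_mult)
  obtain B where "\<forall>w \<in> \<phi> ` {0..1}. norm w \<le> B"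
    using compact_imp_bounded[OF compact_continuous_image[OF \<phi>_cont compact_Icc]]
    unfolding bounded_iff by blast
  then have B: "norm (\<phi> v) \<le> B" if "v \<in> {0..1}" for v
    using that by blast
  have g_bound: "\<bar>g y\<bar> \<le> B" if "y > 0" for y
    using B[of "exp (- y)"] that by (simp add: \<phi>_exp)
  have D: "integrable lborel ?D"
  proof (rule Bochner_Integration.integrable_bound)
    show "integrable lborel (\<lambda>y. B * ?M y)"
      using M by simp
    have "(\<lambda>y. indicator {0<..} y *\<^sub>R (exp (- y) * (g y)\<^sup>2)) \<in> borel_measurable borel"
      by (intro borel_measurable_continuous_on_indicator continuous_intros)
         (auto intro: continuous_on_subset[OF g_cont])
    then show "?D \<in> borel_measurable lborel"
      by simp
    show "AE y in lborel. norm (?D y) \<le> norm (B * ?M y)"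
    proof (rule AE_I2)
      fix y
      show "norm (?D y) \<le> norm (B * ?M y)"
      proof (cases "y > 0")
        case True
        then have "\<bar>g y\<bar> * \<bar>g y\<bar> \<le> \<bar>B\<bar> * \<bar>g y\<bar>"
          using g_bound[OF True] by (intro mult_right_mono) auto
        then have "(g y)\<^sup>2 \<le> \<bar>B\<bar> * \<bar>g y\<bar>"
          by (simp add: power2_eq_square)
        then have "exp (- y) * (g y)\<^sup>2 \<le> exp (- y) * (\<bar>B\<bar> * \<bar>g y\<bar>)"
          by (intro mult_left_mono) auto
        then show ?thesis
          using True by (simp add: abs_mult mult_ac)
      qed simp
    qed
  qed
  \<comment> \<open>Weierstrass approximation: vanishing moments allow \<open>g * g\<close> to be
    replaced by \<open>g * (g - p)\<close> under the integral, and \<open>p\<close> is uniformly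
    within \<open>e\<close> of \<open>\<phi>\<close>. Since \<open>?M\<close> does not depend on
    \<open>e\<close>, the integral of the square must vanish.\<close>
  have le: "integral\<^sup>L lborel ?D \<le> e * integral\<^sup>L lborel ?M" if e: "e > 0" for e
  proof -
    obtain p where p: "real_polynomial_function p" "\<And>v. v \<in> {0..1} \<Longrightarrow> \<bar>\<phi> v - p v\<bar> < e"
      using Stone_Weierstrass_real_polynomial_function[OF compact_Icc \<phi>_cont e] by auto
    obtain a n where pe: "p = (\<lambda>x. \<Sum>i\<le>n. a i * x ^ i)"
      using p(1) unfolding real_polynomial_function_iff_sum by auto
    have P: "has_bochner_integral lborel (\<lambda>y. \<Sum>i\<le>n. a i * ?E i y) (\<Sum>i\<le>n. a i * 0)"
      by (intro has_bochner_integral_sum has_bochner_integral_mult_right E)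
    have "integral\<^sup>L lborel ?D = (\<integral>y. ?D y - (\<Sum>i\<le>n. a i * ?E i y) \<partial>lborel)"
      using P D by (simp add: has_bochner_integral_iff)
    also have "\<dots> \<le> (\<integral>y. e * ?M y \<partial>lborel)"
    proof (rule integral_mono)
      show "integrable lborel (\<lambda>y. ?D y - (\<Sum>i\<le>n. a i * ?E i y))"
        using P D by (auto simp: has_bochner_integral_iff)
      show "integrable lborel (\<lambda>y. e * ?M y)" using M by simp
      fix y
      show "?D y - (\<Sum>i\<le>n. a i * ?E i y) \<le> e * ?M y"
      proof (cases "y > 0")
        case True
        have "\<bar>g y - p (exp (- y))\<bar> \<le> e"
          using p(2)[of "exp (- y)"] True by (simp add: \<phi>_exp)
        then have "g y * (g y - p (exp (- y))) \<le> \<bar>g y\<bar> * e"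
          by (metis abs_ge_self abs_mult abs_ge_zero mult_left_mono order_trans)
        then have "exp (- y) * (g y * (g y - p (exp (- y)))) \<le> exp (- y) * (\<bar>g y\<bar> * e)"
          by simp
        moreover have "?D y - (\<Sum>i\<le>n. a i * ?E i y) = exp (- y) * (g y * (g y - p (exp (- y))))"
          using True by (simp add: pe sum_distrib_left sum_distrib_right power2_eq_square algebra_simps)
        ultimately show ?thesis
          using True by (simp add: mult_ac)
      qed simp
    qed
    also have "\<dots> = e * integral\<^sup>L lborel ?M" by simp
    finally show ?thesis .
  qed
  have "integral\<^sup>L lborel ?D \<le> 0"
  proof (rule field_le_epsilon)
    fix e :: real assume e: "e > 0"
    have K: "integral\<^sup>L lborel ?M \<ge> 0" by (rule integral_nonneg_AE) auto
    have "integral\<^sup>L lborel ?D \<le> e / (integral\<^sup>L lborel ?M + 1) * integral\<^sup>L lborel ?M"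
      using e K by (intro le divide_pos_pos add_nonneg_pos) auto
    also have "\<dots> \<le> e"
    proof -
      have "e / (k + 1) * k \<le> e" if "k \<ge> 0" for k
        using that e by (simp add: field_simps)
      then show ?thesis using K by blast
    qed
    finally show "integral\<^sup>L lborel ?D \<le> 0 + e" by simp
  qed
  moreover have "integral\<^sup>L lborel ?D \<ge> 0"
    by (rule integral_nonneg_AE) auto
  ultimately have "integral\<^sup>L lborel ?D = 0" by simp
  then have AE: "AE y in lborel. ?D y = 0"
    using D by (subst (asm) integral_nonneg_eq_0_iff_AE) auto
  \<comment> \<open>Vanishing almost everywhere becomes vanishing everywhere, because by continuity
    the exceptional set is open and a negligible open set is empty.\<close>
  define Z where "Z = {y \<in> {0<..}. u y \<noteq> 0}"
  have "open Z"
    unfolding Z_def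
    by (rule continuous_open_preimage[OF continuous_on_subset[OF cont], of _ "- {0}", unfolded vimage_def Int_def, simplified])
       (auto simp: Z_def)
  have "Z \<in> null_sets lborel"
  proof (rule iffD2[OF AE_iff_null_sets])
    show "Z \<in> sets lborel" using \<open>open Z\<close> by simp
    show "AE y in lborel. y \<notin> Z"
      using AE by eventually_elim (auto simp: Z_def g_def indicator_def)
  qed
  then have "negligible Z"
    by (simp add: negligible_iff_null_sets null_sets_completionI)
  then have "Z = {}"
    using \<open>open Z\<close> open_not_negligible by blast
  then show ?thesis
    using y by (auto simp: Z_def)
qed

subsection \<open>The Stieltjes representation\<close>

lemma contour_integral_linepath_same_Im:
  assumes "a < b"
  shows "contour_integral (linepath (Complex a c) (Complex b c)) f = integral {a..b} (\<lambda>x. f (Complex x c))"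
proof -
  have "contour_integral (linepath (Complex a c) (Complex b c)) f =
      (Complex b c - Complex a c) * integral {0..1} (\<lambda>x. f (linepath (Complex a c) (Complex b c) x))"
    by (simp add: contour_integral_integral)
  also have "Complex b c - Complex a c = of_real (b - a)"
    by (simp add: complex_eq_iff)
  also have "integral {0..1} (\<lambda>x. f (linepath (Complex a c) (Complex b c) x)) =
      integral {0..1} (\<lambda>x. f (Complex (a + (b - a) * x) c))"
    by (intro integral_cong arg_cong[of _ _ f]) (simp add: linepath_def complex_eq_iff algebra_simps)
  also have "{0..1} = (\<lambda>x. x / (b - a)) ` {0..b - a}"
    using \<open>a < b\<close> by simp
  also have "integral \<dots> (\<lambda>x. f (Complex (a + (b - a) * x) c)) =
      integral {a-a..b-a} (\<lambda>x. f (Complex (x + a) c)) / of_real (b - a)"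
    using \<open>a < b\<close> by (subst integral_stretch_real) (auto simp: scaleR_conv_of_real add_ac)
  also have "\<dots> = integral {a..b} (\<lambda>x. f (Complex x c)) / of_real (b - a)"
    by (subst integral_shift_real_ivl) (rule refl)
  finally show ?thesis
    using \<open>a < b\<close> by simp
qed

text \<open>The horizontal sides are merged into one integral of a difference, which becomes the
  jump across the cut when they lie at heights \<open>- pi\<close> and \<open>pi\<close>. The
  vertical sides stay separate because they will be estimated.\<close>

lemma contour_integral_rectpath:
  assumes "a < b" "c < d" and cont: "continuous_on (path_image (rectpath (Complex a c) (Complex b d))) f"
  shows "contour_integral (rectpath (Complex a c) (Complex b d)) f =
    integral {a..b} (\<lambda>x. f (Complex x c) - f (Complex x d))
    + contour_integral (linepath (Complex b c) (Complex b d)) f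
    - contour_integral (linepath (Complex a c) (Complex a d)) f"
proof -
  have sub: "closed_segment (Complex a c) (Complex b c) \<subseteq> path_image (rectpath (Complex a c) (Complex b d))"
    "closed_segment (Complex a d) (Complex b d) \<subseteq> path_image (rectpath (Complex a c) (Complex b d))"
    "closed_segment (Complex a c) (Complex a d) \<subseteq> path_image (rectpath (Complex a c) (Complex b d))"
    "closed_segment (Complex b c) (Complex b d) \<subseteq> path_image (rectpath (Complex a c) (Complex b d))"
    using assms by (auto simp: path_image_rectpath closed_segment_same_Re closed_segment_same_Im closed_segment_eq_real_ivl)
  note int = contour_integrable_continuous_linepath[OF continuous_on_subset[OF cont]]
  have ints: "f contour_integrable_on linepath (Complex a c) (Complex b c)"
    "f contour_integrable_on linepath (Complex b c) (Complex b d)"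
    "f contour_integrable_on linepath (Complex b d) (Complex a d)"
    "f contour_integrable_on linepath (Complex a d) (Complex a c)"
    using int sub by (auto simp: closed_segment_commute)
  have rev: "contour_integral (linepath z w) f = - contour_integral (linepath w z) f" for z w
    using contour_integral_reversepath[of "linepath w z" f] by simp
  have "contour_integral (rectpath (Complex a c) (Complex b d)) f =
      contour_integral (linepath (Complex a c) (Complex b c)) f
      + contour_integral (linepath (Complex b c) (Complex b d)) f
      - contour_integral (linepath (Complex a d) (Complex b d)) f
      - contour_integral (linepath (Complex a c) (Complex a d)) f"
    unfolding rectpath_def Let_def using ints
    by (simp add: rev[of "Complex b d" "Complex a d"] rev[of "Complex a d" "Complex a c"])
  also have "\<dots> = integral {a..b} (\<lambda>x. f (Complex x c)) - integral {a..b} (\<lambda>x. f (Complex x d))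
    + contour_integral (linepath (Complex b c) (Complex b d)) f
    - contour_integral (linepath (Complex a c) (Complex a d)) f"
    using \<open>a < b\<close> by (simp add: contour_integral_linepath_same_Im)
  also have "integral {a..b} (\<lambda>x. f (Complex x c)) - integral {a..b} (\<lambda>x. f (Complex x d))
      = integral {a..b} (\<lambda>x. f (Complex x c) - f (Complex x d))"
  proof (rule integral_diff[symmetric]; rule integrable_continuous_real)
    show "continuous_on {a..b} (\<lambda>x. f (Complex x c))"
      by (rule continuous_on_compose2[OF cont])
         (use assms in \<open>auto simp: path_image_rectpath Complex_eq intro!: continuous_intros\<close>)
    show "continuous_on {a..b} (\<lambda>x. f (Complex x d))"
      by (rule continuous_on_compose2[OF cont])
         (use assms in \<open>auto simp: path_image_rectpath Complex_eq intro!: continuous_intros\<close>)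
  qed
  finally show ?thesis .
qed

section \<open>The kernel in the logarithmic variable: jump, zeros and residues\<close>

lemma exp_plus_exp_minus_Complex:
  "exp (Complex a b) + exp (- Complex a b) = Complex (2 * (cosh a * cos b)) (2 * (sinh a * sin b))"
  by (simp add: complex_eq_iff Re_exp Im_exp cosh_def sinh_def algebra_simps)

text \<open>This is the squared modulus of cosh at \<open>a + \<i> * b\<close>. It produces the
  denominator of \<open>ml_weight\<close> and, with the cosine dropped, a lower bound for the kernel
  on vertical lines.\<close>

lemma cosh_cos_sinh_sin:
  fixes a b :: real
  shows "(cosh a * cos b)\<^sup>2 + (sinh a * sin b)\<^sup>2 = (sinh a)\<^sup>2 + (cos b)\<^sup>2"
proof -
  have "(cosh a)\<^sup>2 = (sinh a)\<^sup>2 + 1" "(sin b)\<^sup>2 + (cos b)\<^sup>2 = 1"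
    by (simp_all add: cosh_square_eq)
  then show ?thesis
    unfolding power_mult_distrib by algebra
qed

definition ml_weight :: "real \<Rightarrow> real \<Rightarrow> real" where
  "ml_weight \<alpha> x = sinh (\<alpha> * x) / ((sinh (\<alpha> * x))\<^sup>2 + (cos (pi * \<alpha>))\<^sup>2)"

text \<open>The angle \<theta> of the poles: \<open>\<plusminus>\<i> * ml_pole \<alpha>\<close> are
  the zeros of cosh at \<open>\<alpha> * z\<close> nearest to the origin.\<close>

definition ml_pole :: "real \<Rightarrow> real" where
  "ml_pole \<alpha> = pi / (2 * \<alpha>)"

text \<open>
  For \<open>\<zeta> = exp z\<close> one has \<open>dz / ml_kernel \<alpha> s z = \<zeta>\<^sup>\<alpha>\<^sup>-\<^sup>1 d\<zeta> / ((s - \<zeta>) (\<zeta>\<^sup>2\<^sup>\<alpha> + 1))\<close>.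
\<close>

definition ml_kernel :: "real \<Rightarrow> real \<Rightarrow> complex \<Rightarrow> complex" where
  "ml_kernel \<alpha> s z = (of_real s - exp z) * (exp (of_real \<alpha> * z) + exp (- (of_real \<alpha> * z)))"

lemma ml_kernel_Complex:
  "ml_kernel \<alpha> s (Complex a b) = (of_real s - exp (Complex a b)) *
     Complex (2 * (cosh (\<alpha> * a) * cos (\<alpha> * b))) (2 * (sinh (\<alpha> * a) * sin (\<alpha> * b)))"
proof -
  have "of_real \<alpha> * Complex a b = Complex (\<alpha> * a) (\<alpha> * b)"
    by (simp add: complex_eq_iff)
  then show ?thesis
    by (simp only: ml_kernel_def exp_plus_exp_minus_Complex)
qed

text \<open>On both edges of the cut \<open>exp z = - exp x\<close>, so the first factor is the same
  real number \<open>s + exp x\<close>. The second factors are conjugate to each other, and the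
  difference of their reciprocals is purely imaginary.\<close>

lemma ml_kernel_jump:
  assumes s: "s > 0" and c: "cos (pi * \<alpha>) \<noteq> 0"
  shows "1 / ml_kernel \<alpha> s (Complex x (- pi)) - 1 / ml_kernel \<alpha> s (Complex x pi) =
    \<i> * of_real (sin (pi * \<alpha>) * (ml_weight \<alpha> x / (s + exp x)))"
proof -
  define p q where "p = cosh (\<alpha> * x) * cos (pi * \<alpha>)" and "q = sinh (\<alpha> * x) * sin (pi * \<alpha>)"
  define e where "e = s + exp x"
  have e: "e > 0" unfolding e_def using s by (simp add: add_pos_pos)
  have ee: "complex_of_real s - exp (Complex x (- pi)) = of_real e" "complex_of_real s - exp (Complex x pi) = of_real e"
    by (simp_all add: e_def complex_eq_iff Re_exp Im_exp)
  have pq: "p\<^sup>2 + q\<^sup>2 = (sinh (\<alpha> * x))\<^sup>2 + (cos (pi * \<alpha>))\<^sup>2"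
    by (simp add: p_def q_def cosh_cos_sinh_sin)
  have p: "p \<noteq> 0"
    using c cosh_real_pos[of "\<alpha> * x"] by (auto simp: p_def simp del: cosh_real_pos)
  have k: "ml_kernel \<alpha> s (Complex x (- pi)) = of_real e * Complex (2 * p) (- 2 * q)"
    "ml_kernel \<alpha> s (Complex x pi) = of_real e * Complex (2 * p) (2 * q)"
    unfolding ml_kernel_Complex ee by (simp_all add: p_def q_def mult.commute)
  have pq0: "p\<^sup>2 + q\<^sup>2 > 0" using p by (simp add: add_pos_nonneg)
  have "1 / Complex (2 * p) (- 2 * q) - 1 / Complex (2 * p) (2 * q) = \<i> * of_real (q / (p\<^sup>2 + q\<^sup>2))"
  proof -
    have frac: "1 / X - 1 / Y = (Y - X) / (X * Y)" if "X \<noteq> 0" "Y \<noteq> 0" for X Y :: complex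
      using that by (simp add: field_simps)
    have "Complex (2 * p) (- 2 * q) * Complex (2 * p) (2 * q) = of_real (4 * (p\<^sup>2 + q\<^sup>2))"
      by (simp add: complex_eq_iff power2_eq_square algebra_simps)
    moreover have "Complex (2 * p) (2 * q) - Complex (2 * p) (- 2 * q) = \<i> * of_real (4 * q)"
      by (simp add: complex_eq_iff)
    moreover have nz: "Complex (2 * p) (- 2 * q) \<noteq> 0" "Complex (2 * p) (2 * q) \<noteq> 0"
      using p by (auto simp: complex_eq_iff)
    ultimately have "1 / Complex (2 * p) (- 2 * q) - 1 / Complex (2 * p) (2 * q) =
        \<i> * of_real (4 * q) / of_real (4 * (p\<^sup>2 + q\<^sup>2))"
      unfolding frac[OF nz] by (simp only:)
    also have "\<dots> = \<i> * of_real ((4 * q) / (4 * (p\<^sup>2 + q\<^sup>2)))"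
      by (simp only: of_real_divide times_divide_eq_right)
    also have "(4 * q) / (4 * (p\<^sup>2 + q\<^sup>2)) = q / (p\<^sup>2 + q\<^sup>2)"
      by (rule mult_divide_mult_cancel_left) simp
    finally show ?thesis .
  qed
  moreover have "q / (p\<^sup>2 + q\<^sup>2) = sin (pi * \<alpha>) * ml_weight \<alpha> x"
    unfolding pq by (simp add: q_def ml_weight_def)
  ultimately have *: "1 / Complex (2 * p) (- 2 * q) - 1 / Complex (2 * p) (2 * q) = \<i> * of_real (sin (pi * \<alpha>) * ml_weight \<alpha> x)"
    by simp
  have "1 / ml_kernel \<alpha> s (Complex x (- pi)) - 1 / ml_kernel \<alpha> s (Complex x pi)
      = (1 / Complex (2 * p) (- 2 * q) - 1 / Complex (2 * p) (2 * q)) / of_real e"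
    unfolding k by (simp add: diff_divide_distrib mult.commute)
  then show ?thesis
    unfolding * by (simp add: e_def)
qed

text \<open>Zeros of the first factor differ by multiples of \<open>2 * pi * \<i>\<close>; those of
  the second are the odd multiples of \<open>\<i> * ml_pole \<alpha>\<close>. The two bounds on
  \<open>Im z\<close> leave only the multiple 0 in the first family and \<plusminus>1 in the
  second.\<close>

lemma ml_kernel_eq_0D:
  assumes \<alpha>: "0 < \<alpha>" and s: "s > 0" and z: "ml_kernel \<alpha> s z = 0"
    and Im: "\<bar>Im z\<bar> < 2 * pi" "\<bar>Im z\<bar> < 3 * ml_pole \<alpha>"
  shows "z \<in> {of_real (ln s), \<i> * of_real (ml_pole \<alpha>), - \<i> * of_real (ml_pole \<alpha>)}"
proof -
  obtain a b where ab: "z = Complex a b" by (cases z)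
  consider "exp z = of_real s" | "Complex (2 * (cosh (\<alpha> * a) * cos (\<alpha> * b))) (2 * (sinh (\<alpha> * a) * sin (\<alpha> * b))) = 0"
    using z unfolding ab ml_kernel_Complex by auto
  then show ?thesis
  proof cases
    case 1
    have "exp z = exp (of_real (ln s))"
      using 1 s by (simp add: exp_of_real)
    then obtain n :: int where n: "z = of_real (ln s) + of_real (of_int (2 * n) * pi) * \<i>"
      unfolding exp_eq by blast
    then have "\<bar>2 * of_int n * pi\<bar> < 2 * pi"
      using Im by simp
    then have "\<bar>real_of_int n\<bar> < 1" by (simp add: abs_mult)
    then have "n = 0" by linarith
    then show ?thesis using n by simp
  next
    case 2
    then have c: "cos (\<alpha> * b) = 0" and sn: "sinh (\<alpha> * a) * sin (\<alpha> * b) = 0"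
      using cosh_real_pos[of "\<alpha> * a"] by (auto simp: complex_eq_iff simp del: cosh_real_pos)
    have "sin (\<alpha> * b) \<noteq> 0" using c sin_cos_squared_add[of "\<alpha> * b"] by auto
    then have a: "a = 0" using sn \<alpha> by simp
    obtain i :: int where i: "odd i" "\<alpha> * b = of_int i * (pi / 2)"
      using c unfolding cos_zero_iff_int by blast
    have b: "b = of_int i * ml_pole \<alpha>"
      using i(2) \<alpha> by (simp add: ml_pole_def field_simps)
    have "\<bar>real_of_int i\<bar> * ml_pole \<alpha> < 3 * ml_pole \<alpha>"
      using Im(2) \<alpha> b by (simp add: ab abs_mult ml_pole_def)
    moreover have "ml_pole \<alpha> \<ge> 0"
      using \<alpha> by (simp add: ml_pole_def)
    ultimately have "\<bar>real_of_int i\<bar> < 3"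
      by (rule mult_right_less_imp_less)
    then have "\<bar>i\<bar> < 3" by linarith
    then have "i = 1 \<or> i = -1" using i(1) by presburger
    then show ?thesis
      using b a by (auto simp: ab complex_eq_iff)
  qed
qed

lemma ml_kernel_has_field_derivative:
  "(ml_kernel \<alpha> s has_field_derivative
     (of_real s - exp z) * (of_real \<alpha> * (exp (of_real \<alpha> * z) - exp (- (of_real \<alpha> * z))))
     - exp z * (exp (of_real \<alpha> * z) + exp (- (of_real \<alpha> * z)))) (at z)"
  unfolding ml_kernel_def by (auto intro!: derivative_eq_intros simp: algebra_simps)

lemma ml_kernel_holomorphic: "ml_kernel \<alpha> s holomorphic_on UNIV"
  using ml_kernel_has_field_derivative by (auto simp: holomorphic_on_def field_differentiable_def)

lemma ml_kernel_residue:
  assumes "ml_kernel \<alpha> s z = 0" and "(ml_kernel \<alpha> s has_field_derivative d) (at z)" and "d \<noteq> 0"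
  shows "residue (\<lambda>z. 1 / ml_kernel \<alpha> s z) z = 1 / d"
  by (rule residue_simple_pole_deriv[of "\<lambda>_. 1" UNIV]) (use assms ml_kernel_holomorphic in auto)

text \<open>All three poles are simple, so each residue is a reciprocal derivative. The assumption
  \<open>s > 1\<close> keeps \<open>s\<close> off the unit circle, where
  \<open>cis (ml_pole \<alpha>)\<close> lies. The residues at the conjugate pair are conjugate, so
  their sum is real.\<close>

lemma
  assumes \<alpha>: "0 < \<alpha>" and s: "s > 1"
  shows ml_kernel_residue_ln: "residue (\<lambda>z. 1 / ml_kernel \<alpha> s z) (of_real (ln s)) =
      - of_real (s powr (\<alpha> - 1) / (s powr (2 * \<alpha>) + 1))"
    and ml_kernel_residue_pole: "residue (\<lambda>z. 1 / ml_kernel \<alpha> s z) (\<i> * of_real (ml_pole \<alpha>))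
      + residue (\<lambda>z. 1 / ml_kernel \<alpha> s z) (- \<i> * of_real (ml_pole \<alpha>)) =
      of_real (Im (1 / (of_real s - cis (ml_pole \<alpha>))) / \<alpha>)"
proof -
  have s0: "s > 0" using s by simp
  have e: "exp (complex_of_real (ln s)) = of_real s"
    using s0 by (simp add: exp_of_real)
  have ea: "exp (complex_of_real \<alpha> * of_real (ln s)) = of_real (s powr \<alpha>)"
    "exp (- (complex_of_real \<alpha> * of_real (ln s))) = of_real (s powr (- \<alpha>))"
    using s0 by (simp_all add: powr_def flip: exp_of_real)
  have pos: "s * (s powr \<alpha> + s powr (- \<alpha>)) > 0"
    using s0 by (intro mult_pos_pos add_pos_pos) auto
  have "residue (\<lambda>z. 1 / ml_kernel \<alpha> s z) (of_real (ln s)) = 1 / (- of_real (s * (s powr \<alpha> + s powr (- \<alpha>))))"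
  proof (rule ml_kernel_residue)
    show "ml_kernel \<alpha> s (of_real (ln s)) = 0" by (simp add: ml_kernel_def e)
    show "(ml_kernel \<alpha> s has_field_derivative - of_real (s * (s powr \<alpha> + s powr (- \<alpha>)))) (at (of_real (ln s)))"
      using ml_kernel_has_field_derivative[of \<alpha> s "of_real (ln s)"] unfolding e ea by simp
    show "- complex_of_real (s * (s powr \<alpha> + s powr (- \<alpha>))) \<noteq> 0"
      using less_imp_neq[OF pos] by (simp only: neg_equal_0_iff_equal of_real_eq_0_iff)
  qed
  also have "\<dots> = - of_real (1 / (s * (s powr \<alpha> + s powr (- \<alpha>))))"
    by simp
  also have "1 / (s * (s powr \<alpha> + s powr (- \<alpha>))) = s powr (\<alpha> - 1) / (s powr (2 * \<alpha>) + 1)"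
  proof -
    have "s powr (2 * \<alpha>) + 1 = s powr \<alpha> * (s powr \<alpha> + s powr (- \<alpha>))"
      using s0 by (simp add: distrib_left flip: powr_add)
    moreover have "s powr (\<alpha> - 1) = s powr \<alpha> / s" using s0 by (simp add: powr_diff)
    moreover have "1 / (s * (a + b)) = (a / s) / (a * (a + b))" if "a > 0" for a b :: real
      using that by simp
    ultimately show ?thesis using s0 by simp
  qed
  finally show "residue (\<lambda>z. 1 / ml_kernel \<alpha> s z) (of_real (ln s)) =
      - of_real (s powr (\<alpha> - 1) / (s powr (2 * \<alpha>) + 1))" .
next
  let ?t = "ml_pole \<alpha>"
  have at: "\<alpha> * ?t = pi / 2" using \<alpha> by (simp add: ml_pole_def)
  have n: "complex_of_real s \<noteq> cis r" for r
    using s by (metis abs_of_pos norm_cis norm_of_real less_irrefl less_trans zero_less_one)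
  have x: "complex_of_real \<alpha> * (\<i> * of_real ?t) = \<i> * of_real (pi / 2)"
    unfolding at[symmetric] by simp
  have ex: "exp (complex_of_real \<alpha> * (\<i> * of_real ?t)) = \<i>" "exp (- (complex_of_real \<alpha> * (\<i> * of_real ?t))) = - \<i>"
    unfolding x by (simp_all add: complex_eq_iff Re_exp Im_exp)
  have x': "complex_of_real \<alpha> * (- \<i> * of_real ?t) = - (complex_of_real \<alpha> * (\<i> * of_real ?t))"
    by simp
  have e1: "exp (\<i> * complex_of_real ?t) = cis ?t" and e2: "exp (- \<i> * complex_of_real ?t) = cis (- ?t)"
    by (simp_all add: cis_conv_exp)
  have r1: "residue (\<lambda>z. 1 / ml_kernel \<alpha> s z) (\<i> * of_real ?t) = 1 / ((of_real s - cis ?t) * (2 * of_real \<alpha> * \<i>))"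
  proof (rule ml_kernel_residue)
    show "ml_kernel \<alpha> s (\<i> * of_real ?t) = 0" unfolding ml_kernel_def ex by simp
    show "(ml_kernel \<alpha> s has_field_derivative (of_real s - cis ?t) * (2 * of_real \<alpha> * \<i>)) (at (\<i> * of_real ?t))"
      using ml_kernel_has_field_derivative[of \<alpha> s "\<i> * of_real ?t"] unfolding ex e1 by (simp add: algebra_simps)
    show "(of_real s - cis ?t) * (2 * of_real \<alpha> * \<i>) \<noteq> 0" using n \<alpha> by simp
  qed
  have r2: "residue (\<lambda>z. 1 / ml_kernel \<alpha> s z) (- \<i> * of_real ?t) = 1 / ((of_real s - cis (- ?t)) * (- 2 * of_real \<alpha> * \<i>))"
  proof (rule ml_kernel_residue)
    show "ml_kernel \<alpha> s (- \<i> * of_real ?t) = 0" unfolding ml_kernel_def x' minus_minus ex by simp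
    show "(ml_kernel \<alpha> s has_field_derivative (of_real s - cis (- ?t)) * (- 2 * of_real \<alpha> * \<i>)) (at (- \<i> * of_real ?t))"
      using ml_kernel_has_field_derivative[of \<alpha> s "- \<i> * of_real ?t"] unfolding x' minus_minus ex e2 by (simp add: algebra_simps)
    show "(of_real s - cis (- ?t)) * (- 2 * of_real \<alpha> * \<i>) \<noteq> 0" using n \<alpha> by simp
  qed
  define v where "v = 1 / (complex_of_real s - cis ?t)"
  have v': "1 / (complex_of_real s - cis (- ?t)) = cnj v" by (simp add: v_def cis_cnj)
  have "1 / ((of_real s - cis ?t) * (2 * of_real \<alpha> * \<i>)) + 1 / ((of_real s - cis (- ?t)) * (- 2 * of_real \<alpha> * \<i>))
      = (v - cnj v) / (2 * of_real \<alpha> * \<i>)"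
    unfolding v'[symmetric] v_def by (simp add: cis_cnj diff_divide_distrib mult.commute)
  also have "v - cnj v = 2 * \<i> * of_real (Im v)" by (simp add: complex_eq_iff)
  also have "2 * \<i> * of_real (Im v) / (2 * of_real \<alpha> * \<i>) = of_real (Im v / \<alpha>)"
    by simp
  finally show "residue (\<lambda>z. 1 / ml_kernel \<alpha> s z) (\<i> * of_real ?t)
      + residue (\<lambda>z. 1 / ml_kernel \<alpha> s z) (- \<i> * of_real ?t) = of_real (Im (1 / (of_real s - cis ?t)) / \<alpha>)"
    unfolding r1 r2 v_def .
qed

section \<open>The limit of growing rectangles\<close>

lemma ml_weight_minus: "ml_weight \<alpha> (- x) = - ml_weight \<alpha> x"
  by (simp add: ml_weight_def)

lemma ml_weight_denominator_pos:
  "cos (pi * \<alpha>) \<noteq> 0 \<Longrightarrow> (sinh (\<alpha> * x))\<^sup>2 + (cos (pi * \<alpha>))\<^sup>2 > (0::real)"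
  by (simp add: add_nonneg_pos)

lemma continuous_on_ml_weight [continuous_intros]:
  "cos (pi * \<alpha>) \<noteq> 0 \<Longrightarrow> continuous_on A f \<Longrightarrow> continuous_on A (\<lambda>x. ml_weight \<alpha> (f x))"
  unfolding ml_weight_def
  using ml_weight_denominator_pos[of \<alpha>]
  by (auto intro!: continuous_intros simp: less_imp_neq[symmetric])

lemma cos_pi_mult_neq_0:
  assumes "0 < \<alpha>" "\<alpha> < 1" "\<alpha> \<noteq> 1/2"
  shows "cos (pi * \<alpha>) \<noteq> 0"
proof
  assume "cos (pi * \<alpha>) = 0"
  then obtain i :: int where i: "odd i" "pi * \<alpha> = of_int i * (pi / 2)"
    unfolding cos_zero_iff_int by blast
  then have *: "2 * \<alpha> = of_int i" by simp
  then have "0 < i" "i < 2" using assms by linarith+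
  then have "i = 1" by simp
  with * show False using assms by simp
qed

text \<open>On the right side \<open>norm (exp z) = exp N \<ge> 2 * s\<close>, on the left it is at
  most 1; either way the first factor has modulus at least \<open>s - 1\<close>. The second factor
  has modulus at least \<open>2 * sinh (\<alpha> * N)\<close> on both sides.\<close>

lemma norm_inverse_ml_kernel_le:
  assumes \<alpha>: "\<alpha> > 0" and s: "s > 1" and N: "N > 0" "exp N \<ge> 2 * s" and x: "x = N \<or> x = - N"
  shows "norm (1 / ml_kernel \<alpha> s (Complex x y)) \<le> 1 / ((s - 1) * (2 * sinh (\<alpha> * N)))"
proof -
  have sh: "sinh (\<alpha> * N) > 0" using \<alpha> N by simp
  have 1: "norm (of_real s - exp (Complex x y)) \<ge> s - 1"
  proof (cases "x = N")
    case True
    have "norm (exp (Complex x y) - of_real s) \<ge> norm (exp (Complex x y)) - norm (complex_of_real s)"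
      by (rule norm_triangle_ineq2)
    then show ?thesis using N s True by (simp add: norm_minus_commute)
  next
    case False
    then have x: "x = - N" using x by simp
    have "norm (of_real s - exp (Complex x y)) \<ge> norm (complex_of_real s) - norm (exp (Complex x y))"
      by (rule norm_triangle_ineq2)
    moreover have "norm (exp (Complex x y)) \<le> 1" using N x by simp
    moreover have "norm (complex_of_real s) = s" using s by simp
    ultimately show ?thesis by linarith
  qed
  have sq: "(sinh (\<alpha> * x))\<^sup>2 = (sinh (\<alpha> * N))\<^sup>2" using x by auto
  have 2: "norm (Complex (2 * (cosh (\<alpha> * x) * cos (\<alpha> * y))) (2 * (sinh (\<alpha> * x) * sin (\<alpha> * y)))) \<ge> 2 * sinh (\<alpha> * N)"
  proof -
    have "norm (Complex (2 * (cosh (\<alpha> * x) * cos (\<alpha> * y))) (2 * (sinh (\<alpha> * x) * sin (\<alpha> * y))))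
        = sqrt (4 * ((cosh (\<alpha> * x) * cos (\<alpha> * y))\<^sup>2 + (sinh (\<alpha> * x) * sin (\<alpha> * y))\<^sup>2))"
      by (simp add: cmod_def power_mult_distrib algebra_simps)
    also have "\<dots> = sqrt (4 * ((sinh (\<alpha> * N))\<^sup>2 + (cos (\<alpha> * y))\<^sup>2))"
      by (simp only: cosh_cos_sinh_sin sq)
    also have "\<dots> \<ge> 2 * sinh (\<alpha> * N)"
      by (rule real_le_rsqrt) (simp add: power_mult_distrib)
    finally show ?thesis .
  qed
  have P: "0 < (s - 1) * (2 * sinh (\<alpha> * N))"
    using s sh by (intro mult_pos_pos) auto
  have le: "(s - 1) * (2 * sinh (\<alpha> * N)) \<le> norm (ml_kernel \<alpha> s (Complex x y))"
    unfolding ml_kernel_Complex norm_mult using 1 2 s sh by (intro mult_mono) auto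
  show ?thesis
    unfolding norm_divide norm_one
    by (rule divide_left_mono[OF le zero_le_one mult_pos_pos[OF less_le_trans[OF P le] P]])
qed

text \<open>The residue theorem for the reciprocal kernel on the rectangle with corners
  \<open>\<plusminus>N \<plusminus> \<i> * pi\<close>, as \<open>N\<close> tends to infinity.
  \<open>L\<close> is minus the sum of the enclosed residues.\<close>

lemma ml_weight_stieltjes:
  assumes \<alpha>: "0 < \<alpha>" "\<alpha> < 1" "\<alpha> \<noteq> 1/2" and s: "s > 1"
  defines "L \<equiv> s powr (\<alpha> - 1) / (s powr (2 * \<alpha>) + 1)
      - (if \<alpha> > 1/2 then Im (1 / (of_real s - cis (ml_pole \<alpha>))) / \<alpha> else 0)"
  shows "((\<lambda>N. integral {0..N} (\<lambda>x. ml_weight \<alpha> x * (1 / (s + exp (- x)) - 1 / (s + exp x))))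
     \<longlongrightarrow> 2 * pi / sin (pi * \<alpha>) * L) at_top"
proof -
  let ?t = "ml_pole \<alpha>"
  let ?G = "\<lambda>z. 1 / ml_kernel \<alpha> s z"
  let ?I = "\<lambda>N. integral {0..N} (\<lambda>x. ml_weight \<alpha> x * (1 / (s + exp (- x)) - 1 / (s + exp x)))"
  let ?V = "\<lambda>N. contour_integral (linepath (Complex N (- pi)) (Complex N pi)) ?G"
  have c: "cos (pi * \<alpha>) \<noteq> 0" by (rule cos_pi_mult_neq_0[OF \<alpha>])
  have sn: "sin (pi * \<alpha>) > 0" using \<alpha> by (intro sin_gt_zero) auto
  have t: "?t > pi / 2" "?t \<noteq> pi" "?t < pi \<longleftrightarrow> \<alpha> > 1/2"
    using \<alpha> by (auto simp: ml_pole_def field_simps)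
  have t': "- ?t \<noteq> pi"
    using t(1) pi_gt_zero by linarith
  have s0: "s > 0" using s by simp
  have s_exp: "s + exp x \<noteq> 0" for x using s0 exp_gt_zero[of x] by linarith
  \<comment> \<open>An open strip around all the rectangles, yet narrow enough for
    \<open>ml_kernel_eq_0D\<close>; \<open>m\<close> says that the edges of the cut lie inside
    it.\<close>
  define S where "S = {z. - min (2 * pi) (3 * ?t) < Im z} \<inter> {z. Im z < min (2 * pi) (3 * ?t)}"
  have m: "pi < min (2 * pi) (3 * ?t)"
    unfolding min_less_iff_conj using t(1) pi_gt_zero by (intro conjI) linarith+
  define pts where "pts = {of_real (ln s), \<i> * of_real ?t, - \<i> * of_real ?t}"
  have S_open: "open S"
    unfolding S_def by (intro open_Int open_halfspace_Im_gt open_halfspace_Im_lt)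
  have S_conn: "connected S"
    unfolding S_def by (intro convex_connected convex_Int convex_halfspace_Im_gt convex_halfspace_Im_lt)
  have nz: "ml_kernel \<alpha> s z \<noteq> 0" if "z \<in> S - pts" for z
  proof
    assume "ml_kernel \<alpha> s z = 0"
    then have "z \<in> pts" unfolding pts_def
      using that by (intro ml_kernel_eq_0D[OF \<alpha>(1) s0]) (auto simp: S_def)
    then show False using that by simp
  qed
  have G_holo: "?G holomorphic_on S - pts"
    using nz by (intro holomorphic_intros holomorphic_on_subset[OF ml_kernel_holomorphic]) auto
  have main: "complex_of_real (?I N) = of_real (2 * pi / sin (pi * \<alpha>) * L) + (?V N - ?V (- N)) / (\<i> * of_real (sin (pi * \<alpha>)))"
    if N: "N > 0" "N > ln s" for N
  proof -
    let ?R = "rectpath (Complex (- N) (- pi)) (Complex N pi)"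
    have lns: "ln s > 0" using s by simp
    have cbox: "cbox (Complex (- N) (- pi)) (Complex N pi) \<subseteq> S"
      using t pi_gt_zero by (auto simp: S_def in_cbox_complex_iff min_def; linarith)
    have img: "path_image ?R \<subseteq> S - pts"
    proof -
      have "path_image ?R \<subseteq> S"
        using path_image_rectpath_subset_cbox[of "Complex (- N) (- pi)" "Complex N pi"] N cbox by auto
      moreover have "path_image ?R \<inter> pts = {}"
        using N lns t t' by (auto simp: path_image_rectpath pts_def)
      ultimately show ?thesis by blast
    qed
    have wln: "winding_number ?R (of_real (ln s)) = 1"
      using N lns by (intro winding_number_rectpath) (auto simp: in_box_complex_iff)
    \<comment> \<open>The pair of poles lies inside the rectangle exactly when
      \<open>ml_pole \<alpha> < pi\<close>, that is when \<open>\<alpha> > 1/2\<close>. This is the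
      source of the case distinction in \<open>L\<close>.\<close>
    have wt: "winding_number ?R (\<i> * of_real ?t) = (if \<alpha> > 1/2 then 1 else 0)"
      "winding_number ?R (- \<i> * of_real ?t) = (if \<alpha> > 1/2 then 1 else 0)"
    proof (atomize(full), cases "\<alpha> > 1/2")
      case True
      then show "winding_number ?R (\<i> * of_real ?t) = (if \<alpha> > 1/2 then 1 else 0) \<and>
        winding_number ?R (- \<i> * of_real ?t) = (if \<alpha> > 1/2 then 1 else 0)"
        using N t pi_gt_zero by (auto intro!: winding_number_rectpath simp: in_box_complex_iff)
    next
      case False
      then have "?t > pi" using t by auto
      then show "winding_number ?R (\<i> * of_real ?t) = (if \<alpha> > 1/2 then 1 else 0) \<and>
        winding_number ?R (- \<i> * of_real ?t) = (if \<alpha> > 1/2 then 1 else 0)"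
        using False N by (auto intro!: winding_number_rectpath_outside simp: in_cbox_complex_iff)
    qed
    have "contour_integral ?R ?G = 2 * pi * \<i> * (\<Sum>p\<in>pts. winding_number ?R p * residue ?G p)"
    proof (rule Residue_theorem[OF S_open S_conn _ G_holo])
      show "\<forall>z. z \<notin> S \<longrightarrow> winding_number ?R z = 0"
        using cbox N by (auto intro!: winding_number_rectpath_outside)
    qed (use img in \<open>auto simp: pts_def\<close>)
    also have "(\<Sum>p\<in>pts. winding_number ?R p * residue ?G p) =
        residue ?G (of_real (ln s)) + (if \<alpha> > 1/2 then residue ?G (\<i> * of_real ?t) + residue ?G (- \<i> * of_real ?t) else 0)"
    proof -
      have "complex_of_real (ln s) \<noteq> \<i> * of_real ?t" "complex_of_real (ln s) \<noteq> - \<i> * of_real ?t"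
        "\<i> * complex_of_real ?t \<noteq> - \<i> * of_real ?t"
        using lns t pi_gt_zero by (auto simp: complex_eq_iff)
      then show ?thesis
        unfolding pts_def using wln wt by simp
    qed
    also have "\<dots> = of_real (- L)"
      unfolding ml_kernel_residue_ln[OF \<alpha>(1) s] ml_kernel_residue_pole[OF \<alpha>(1) s] by (auto simp: L_def)
    finally have C1: "contour_integral ?R ?G = 2 * pi * \<i> * of_real (- L)" .
    let ?f = "\<lambda>x. ml_weight \<alpha> x / (s + exp x)"
    have fcont: "continuous_on A ?f" for A
      using s_exp by (intro continuous_intros c) auto
    have fint: "?f integrable_on {a..b}" for a b
      by (intro integrable_continuous_real fcont)
    have "contour_integral ?R ?G = integral {- N..N} (\<lambda>x. ?G (Complex x (- pi)) - ?G (Complex x pi)) + ?V N - ?V (- N)"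
      by (rule contour_integral_rectpath)
         (use N img G_holo in \<open>auto intro: continuous_on_subset holomorphic_on_imp_continuous_on\<close>)
    also have "integral {- N..N} (\<lambda>x. ?G (Complex x (- pi)) - ?G (Complex x pi))
        = integral {- N..N} (\<lambda>x. \<i> * of_real (sin (pi * \<alpha>) * ?f x))"
      unfolding ml_kernel_jump[OF s0 c] ..
    also have "\<dots> = \<i> * of_real (sin (pi * \<alpha>) * integral {- N..N} ?f)"
    proof (rule integral_unique)
      have "(?f has_integral integral {- N..N} ?f) {- N..N}"
        using fint by (rule integrable_integral)
      then show "((\<lambda>x. \<i> * complex_of_real (sin (pi * \<alpha>) * ?f x)) has_integral
          \<i> * of_real (sin (pi * \<alpha>) * integral {- N..N} ?f)) {- N..N}"
        by (intro has_integral_mult_right has_integral_of_real)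
    qed
    \<comment> \<open>Reflect the negative half onto the positive one; since the weight is odd, the
      two halves combine into a difference.\<close>
    also have "integral {- N..N} ?f = - ?I N"
    proof -
      have "integral {- N..N} ?f = integral {- N..0} ?f + integral {0..N} ?f"
        using N by (intro Henstock_Kurzweil_Integration.integral_combine[symmetric] fint) auto
      also have "integral {- N..0} ?f = integral {0..N} (\<lambda>x. ?f (- x))"
        using Henstock_Kurzweil_Integration.integral_reflect_real[of "0" "- N" ?f]
        by simp
      also have "\<dots> + integral {0..N} ?f = integral {0..N} (\<lambda>x. ?f (- x) + ?f x)"
        by (intro integral_add[symmetric] integrable_continuous_real continuous_on_compose2[OF fcont[of UNIV]] continuous_intros) auto
      also have "\<dots> = integral {0..N} (\<lambda>x. - (ml_weight \<alpha> x * (1 / (s + exp (- x)) - 1 / (s + exp x))))"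
        by (intro integral_cong) (simp add: ml_weight_minus algebra_simps)
      also have "\<dots> = - ?I N" by (rule integral_neg)
      finally show ?thesis .
    qed
    finally have C2: "contour_integral ?R ?G = \<i> * of_real (sin (pi * \<alpha>) * - ?I N) + ?V N - ?V (- N)" .
    have key: "\<i> * of_real (sin (pi * \<alpha>)) * of_real (?I N) = 2 * pi * \<i> * of_real L + (?V N - ?V (- N))"
      using C1 C2 by (simp add: algebra_simps)
    have lin: "x = a / u + v / u" if "u * x = a + v" "u \<noteq> 0" for x a u v :: complex
      using that by (simp add: field_simps)
    have "of_real (?I N) = 2 * pi * \<i> * of_real L / (\<i> * of_real (sin (pi * \<alpha>))) + (?V N - ?V (- N)) / (\<i> * of_real (sin (pi * \<alpha>)))"
      by (rule lin[OF key]) (use sn in simp)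
    then show ?thesis by simp
  qed
  \<comment> \<open>The length \<open>2 * pi\<close> of a vertical side times the bound for the
    integrand there. It tends to 0 since \<open>sinh (\<alpha> * N)\<close> tends to
    infinity.\<close>
  define B where "B = (\<lambda>N. 1 / ((s - 1) * (2 * sinh (\<alpha> * N))) * (2 * pi))"
  have Vle: "norm (?V x) \<le> B N" if N: "N > 0" "N > ln s" "exp N \<ge> 2 * s" and x: "x = N \<or> x = - N" for x N
  proof -
    have seg: "closed_segment (Complex x (- pi)) (Complex x pi) \<subseteq> S - pts"
    proof
      fix z assume "z \<in> closed_segment (Complex x (- pi)) (Complex x pi)"
      then have z: "Re z = x" "- pi \<le> Im z" "Im z \<le> pi"
        by (auto simp: closed_segment_same_Re closed_segment_eq_real_ivl)
      have "z \<in> S"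
        unfolding S_def using z m by (intro IntI CollectI) linarith+
      moreover have "ln s > 0" using s by simp
      ultimately show "z \<in> S - pts"
        using z N x by (auto simp: pts_def)
    qed
    have "norm (?V x) \<le> 1 / ((s - 1) * (2 * sinh (\<alpha> * N))) * norm (Complex x pi - Complex x (- pi))"
    proof (rule contour_integral_bound_linepath)
      show "?G contour_integrable_on linepath (Complex x (- pi)) (Complex x pi)"
        by (intro contour_integrable_continuous_linepath continuous_on_subset[OF holomorphic_on_imp_continuous_on[OF G_holo] seg])
      show "0 \<le> 1 / ((s - 1) * (2 * sinh (\<alpha> * N)))"
        using \<alpha> s N by simp
      fix z assume "z \<in> closed_segment (Complex x (- pi)) (Complex x pi)"
      then have z: "z = Complex x (Im z)"
        by (auto simp: closed_segment_same_Re complex_eq_iff)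
      show "norm (?G z) \<le> 1 / ((s - 1) * (2 * sinh (\<alpha> * N)))"
        by (subst z, rule norm_inverse_ml_kernel_le) (use \<alpha> s N x in auto)
    qed
    also have "norm (Complex x pi - Complex x (- pi)) = 2 * pi"
      by (simp add: cmod_def real_sqrt_mult)
    finally show ?thesis by (simp add: B_def)
  qed
  have ev: "\<forall>\<^sub>F N in at_top. N > 0 \<and> N > ln s \<and> exp N \<ge> 2 * s"
    by (intro eventually_conj eventually_gt_at_top)
       (use filterlim_at_top[THEN iffD1, OF exp_at_top] in blast)
  have "filterlim (\<lambda>N. sinh (\<alpha> * N)) at_top at_top"
    by (rule filterlim_compose[OF sinh_real_at_top])
       (rule filterlim_tendsto_pos_mult_at_top[OF tendsto_const \<alpha>(1) filterlim_ident])
  then have "filterlim (\<lambda>N. (s - 1) * (2 * sinh (\<alpha> * N))) at_top at_top"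
    using s by (intro filterlim_tendsto_pos_mult_at_top[OF tendsto_const]) auto
  then have "((\<lambda>N. 1 / ((s - 1) * (2 * sinh (\<alpha> * N)))) \<longlongrightarrow> 0) at_top"
    by (rule tendsto_divide_0[OF tendsto_const filterlim_at_top_imp_at_infinity])
  then have B0: "(B \<longlongrightarrow> 0) at_top"
    unfolding B_def by (rule tendsto_mult_left_zero)
  have V0: "((\<lambda>N. ?V N) \<longlongrightarrow> 0) at_top" "((\<lambda>N. ?V (- N)) \<longlongrightarrow> 0) at_top"
    by (rule Lim_null_comparison[OF eventually_mono[OF ev] B0]; blast intro: Vle)+
  have "((\<lambda>N. of_real (2 * pi / sin (pi * \<alpha>) * L) + (?V N - ?V (- N)) / (\<i> * of_real (sin (pi * \<alpha>))))
      \<longlongrightarrow> of_real (2 * pi / sin (pi * \<alpha>) * L) + (0 - 0) / (\<i> * of_real (sin (pi * \<alpha>)))) at_top"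
    by (intro tendsto_intros V0) (use sn in auto)
  then have "((\<lambda>N. complex_of_real (?I N)) \<longlongrightarrow> of_real (2 * pi / sin (pi * \<alpha>) * L) + (0 - 0) / (\<i> * of_real (sin (pi * \<alpha>)))) at_top"
    by (rule Lim_transform_eventually) (use ev in eventually_elim, use main in auto)
  then show ?thesis
    by (simp add: tendsto_of_real_iff del: of_real_mult of_real_divide)
qed

subsection \<open>The integral representation\<close>

definition ml_integral :: "real \<Rightarrow> real \<Rightarrow> real" where
  "ml_integral \<alpha> y = (\<integral>x. indicator {0<..} x * ml_weight \<alpha> x *
     (exp (- (y * exp (- x))) - exp (- (y * exp x))) \<partial>lborel)"

lemma ml_weight_pos:
  assumes "0 < \<alpha>" "x > 0"
  shows "ml_weight \<alpha> x > 0"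
  unfolding ml_weight_def using assms by (intro divide_pos_pos add_pos_nonneg) auto

text \<open>Since \<open>c2 \<le> 1\<close>, the denominator is at least
  \<open>c2 * (cosh a)\<^sup>2\<close>, hence at least \<open>c2 * exp (2 * a) / 4\<close>, while
  the numerator is at most \<open>exp a / 2\<close>.\<close>

lemma ml_weight_le:
  assumes \<alpha>: "0 < \<alpha>" and c: "cos (pi * \<alpha>) \<noteq> 0" and x: "x \<ge> 0"
  shows "ml_weight \<alpha> x \<le> 2 / (cos (pi * \<alpha>))\<^sup>2 * exp (- (\<alpha> * x))"
proof -
  define a c2 where "a = \<alpha> * x" and "c2 = (cos (pi * \<alpha>))\<^sup>2"
  have a: "a \<ge> 0" using \<alpha> x by (simp add: a_def)
  have c2: "0 < c2" "c2 \<le> 1"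
    using c by (auto simp: c2_def abs_square_le_1)
  have "c2 * (exp (2 * a) / 4) \<le> c2 * (cosh a)\<^sup>2"
  proof (rule mult_left_mono)
    have "(exp a / 2)\<^sup>2 \<le> (cosh a)\<^sup>2"
      by (rule power_mono) (auto simp: cosh_def)
    then show "exp (2 * a) / 4 \<le> (cosh a)\<^sup>2"
      by (simp add: power_divide exp_double)
  qed (use c2 in simp)
  also have "\<dots> \<le> (sinh a)\<^sup>2 + c2"
  proof -
    have "c2 * (sinh a)\<^sup>2 \<le> 1 * (sinh a)\<^sup>2"
      using c2 by (intro mult_right_mono) auto
    then show ?thesis by (simp add: cosh_square_eq algebra_simps)
  qed
  finally have den: "c2 * (exp (2 * a) / 4) \<le> (sinh a)\<^sup>2 + c2" .
  have "sinh a / ((sinh a)\<^sup>2 + c2) \<le> (exp a / 2) / (c2 * (exp (2 * a) / 4))"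
    using a c2 den by (intro frac_le) (auto simp: sinh_def)
  also have "\<dots> = 2 / c2 * exp (- a)"
    unfolding exp_double using c2 by (simp add: exp_minus power2_eq_square field_simps)
  finally show ?thesis
    by (simp add: ml_weight_def a_def c2_def)
qed

lemma has_bochner_integral_exp_minus:
  assumes "r > 0"
  shows "has_bochner_integral lborel (\<lambda>y. indicator {0<..} y * exp (- (r * y))) (1 / r :: real)"
proof -
  have *: "indicator {0<..} y * exp (- (r * y)) = indicator {0<..} y *\<^sub>R exp (- (r * y)) *\<^sub>R y powr 0" for y
    by (auto simp: indicator_def)
  have L: "Gamma (0 + 1) / r powr (0 + 1) = 1 / r"
    using assms by simp
  have "has_laplace (\<lambda>y. y powr 0) r (1 / r)"
    unfolding L[symmetric] by (rule has_laplace_powr) (use assms in auto)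
  then show ?thesis
    unfolding * has_laplace_def .
qed

lemma ml_weight_measurable [measurable]: "ml_weight \<alpha> \<in> borel_measurable borel"
  unfolding ml_weight_def sinh_def by measurable

lemma integrable_ml_weight:
  assumes \<alpha>: "0 < \<alpha>" and c: "cos (pi * \<alpha>) \<noteq> 0"
  shows "integrable lborel (\<lambda>x. indicator {0<..} x * ml_weight \<alpha> x)"
proof (rule Bochner_Integration.integrable_bound)
  show "integrable lborel (\<lambda>x. 2 / (cos (pi * \<alpha>))\<^sup>2 * (indicator {0<..} x * exp (- (\<alpha> * x))))"
    using has_bochner_integral_exp_minus[OF \<alpha>] by (intro integrable_mult_right) (simp add: has_bochner_integral_iff)
  show "AE x in lborel. norm (indicator {0<..} x * ml_weight \<alpha> x)
      \<le> norm (2 / (cos (pi * \<alpha>))\<^sup>2 * (indicator {0<..} x * exp (- (\<alpha> * x))))"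
  proof (rule AE_I2)
    fix x
    show "norm (indicator {0<..} x * ml_weight \<alpha> x)
      \<le> norm (2 / (cos (pi * \<alpha>))\<^sup>2 * (indicator {0<..} x * exp (- (\<alpha> * x))))"
      using ml_weight_le[OF \<alpha> c, of x] ml_weight_pos[OF \<alpha>, of x] by (cases "x > 0") auto
  qed
qed measurable

lemma ml_bracket:
  fixes x y :: real
  assumes "y \<ge> 0" "x > 0"
  shows "0 \<le> exp (- (y * exp (- x))) - exp (- (y * exp x))"
    and "exp (- (y * exp (- x))) - exp (- (y * exp x)) \<le> 1"
proof -
  have "y * exp (- x) \<le> y * exp x" using assms by (intro mult_left_mono) auto
  then show "0 \<le> exp (- (y * exp (- x))) - exp (- (y * exp x))" by simp
  have "exp (- (y * exp (- x))) \<le> 1" using assms by simp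
  then show "exp (- (y * exp (- x))) - exp (- (y * exp x)) \<le> 1"
    using exp_gt_zero[of "- (y * exp x)"] by linarith
qed

text \<open>The majorant does not depend on \<open>y\<close>. This one bound gives integrability,
  boundedness and, by dominated convergence, continuity of \<open>ml_integral\<close>.\<close>

lemma norm_ml_integrand_le:
  assumes "0 < \<alpha>" "y \<ge> 0"
  shows "norm (indicator {0<..} x * ml_weight \<alpha> x * (exp (- (y * exp (- x))) - exp (- (y * exp x))))
    \<le> indicator {0<..} x * ml_weight \<alpha> x"
proof (cases "x > 0")
  case True
  show ?thesis
    using ml_bracket[OF assms(2) True] ml_weight_pos[OF assms(1) True] True
    by (simp add: abs_mult mult_left_le)
qed simp

lemma integrable_ml_integrand:
  assumes \<alpha>: "0 < \<alpha>" and c: "cos (pi * \<alpha>) \<noteq> 0" and y: "y \<ge> 0"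
  shows "integrable lborel (\<lambda>x. indicator {0<..} x * ml_weight \<alpha> x *
     (exp (- (y * exp (- x))) - exp (- (y * exp x))))"
proof (rule Bochner_Integration.integrable_bound[OF integrable_ml_weight[OF \<alpha> c]])
  show "AE x in lborel. norm (indicator {0<..} x * ml_weight \<alpha> x * (exp (- (y * exp (- x))) - exp (- (y * exp x))))
    \<le> norm (indicator {0<..} x * ml_weight \<alpha> x)"
    using norm_ml_integrand_le[OF \<alpha> y] by (intro AE_I2) (metis abs_ge_self order_trans real_norm_def)
qed measurable

lemma abs_ml_integral_le:
  assumes \<alpha>: "0 < \<alpha>" and c: "cos (pi * \<alpha>) \<noteq> 0" and y: "y \<ge> 0"
  shows "\<bar>ml_integral \<alpha> y\<bar> \<le> (\<integral>x. indicator {0<..} x * ml_weight \<alpha> x \<partial>lborel)"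
  unfolding ml_integral_def real_norm_def[symmetric]
  by (rule Bochner_Integration.integral_norm_bound_integral[OF integrable_ml_integrand[OF assms] integrable_ml_weight[OF \<alpha> c] norm_ml_integrand_le[OF \<alpha> y]])

lemma continuous_on_ml_integral:
  assumes \<alpha>: "0 < \<alpha>" and c: "cos (pi * \<alpha>) \<noteq> 0"
  shows "continuous_on {0..} (ml_integral \<alpha>)"
  unfolding continuous_on_sequentially
proof (intro allI ballI impI)
  fix X :: "nat \<Rightarrow> real" and a :: real
  assume a: "a \<in> {0..}" and X: "(\<forall>n. X n \<in> {0..}) \<and> X \<longlonglongrightarrow> a"
  show "(ml_integral \<alpha> \<circ> X) \<longlonglongrightarrow> ml_integral \<alpha> a"
    unfolding o_def ml_integral_def
  proof (rule integral_dominated_convergence[OF _ _ integrable_ml_weight[OF \<alpha> c]])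
    show "AE x in lborel. (\<lambda>n. indicator {0<..} x * ml_weight \<alpha> x * (exp (- (X n * exp (- x))) - exp (- (X n * exp x))))
      \<longlonglongrightarrow> indicator {0<..} x * ml_weight \<alpha> x * (exp (- (a * exp (- x))) - exp (- (a * exp x)))"
      using X by (intro AE_I2 tendsto_intros) auto
    show "AE x in lborel. norm (indicator {0<..} x * ml_weight \<alpha> x * (exp (- (X n * exp (- x))) - exp (- (X n * exp x))))
      \<le> indicator {0<..} x * ml_weight \<alpha> x" for n
      using X by (intro AE_I2 norm_ml_integrand_le \<alpha>) auto
  qed measurable
qed

text \<open>Fubini: for fixed \<open>x\<close> the transform in \<open>y\<close> is that of two
  exponentials with rates \<open>exp (- x)\<close> and \<open>exp x\<close>. The double integrand is
  nonnegative, so joint integrability reduces to the iterated integral, which \<open>1 / s\<close>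
  times the weight dominates.\<close>

lemma has_laplace_ml_integral:
  assumes \<alpha>: "0 < \<alpha>" and c: "cos (pi * \<alpha>) \<noteq> 0" and s: "s > 0"
  shows "has_laplace (ml_integral \<alpha>) s
    (\<integral>x. indicator {0<..} x * (ml_weight \<alpha> x * (1 / (s + exp (- x)) - 1 / (s + exp x))) \<partial>lborel)"
proof -
  let ?W = "\<lambda>x. indicator {0<..} x * ml_weight \<alpha> x"
  let ?b = "\<lambda>x y. indicator {0<..} y * (exp (- (s * y)) * (exp (- (y * exp (- x))) - exp (- (y * exp x))))"
  let ?f = "\<lambda>x y. ?W x * ?b x y"
  have b: "has_bochner_integral lborel (?b x) (1 / (s + exp (- x)) - 1 / (s + exp x))" for x
  proof -
    have p: "s + exp (- x) > 0" "s + exp x > 0" using s by (simp_all add: add_pos_pos)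
    have "has_bochner_integral lborel
       (\<lambda>y. indicator {0<..} y * exp (- ((s + exp (- x)) * y)) - indicator {0<..} y * exp (- ((s + exp x) * y)))
       (1 / (s + exp (- x)) - 1 / (s + exp x))"
      by (intro has_bochner_integral_diff has_bochner_integral_exp_minus p)
    moreover have "indicator {0<..} y * exp (- ((s + exp (- x)) * y)) - indicator {0<..} y * exp (- ((s + exp x) * y)) = ?b x y" for y
    proof -
      have e: "exp (- ((s + r) * y)) = exp (- (s * y)) * exp (- (y * r))" for r
        by (simp add: exp_add[symmetric] algebra_simps)
      show ?thesis
        unfolding e by (simp only: right_diff_distrib)
    qed
    ultimately show ?thesis by simp
  qed
  have bi: "integrable lborel (?b x)" and bv: "(\<integral>y. ?b x y \<partial>lborel) = 1 / (s + exp (- x)) - 1 / (s + exp x)" for x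
    using b[of x] by (auto simp: has_bochner_integral_iff)
  have f0: "?f x y \<ge> 0" for x y
    using ml_bracket(1)[of y x] ml_weight_pos[OF \<alpha>, of x]
    by (cases "x > 0"; cases "y > 0") auto
  have fi: "(\<integral>y. ?f x y \<partial>lborel) = ?W x * (1 / (s + exp (- x)) - 1 / (s + exp x))" for x
    by (simp only: integral_mult_right_zero bv)
  have pair: "integrable (lborel \<Otimes>\<^sub>M lborel) (case_prod ?f)"
  proof (rule lborel_pair.Fubini_integrable)
    show "case_prod ?f \<in> borel_measurable (lborel \<Otimes>\<^sub>M lborel)" by measurable
    show "AE x in lborel. integrable lborel (\<lambda>y. case_prod ?f (x, y))"
      by (auto intro!: AE_I2 integrable_mult_right bi)
    have "(\<integral>y. norm (case_prod ?f (x, y)) \<partial>lborel) = ?W x * (1 / (s + exp (- x)) - 1 / (s + exp x))" for x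
      using f0 fi[of x] by simp
    moreover have "integrable lborel (\<lambda>x. ?W x * (1 / (s + exp (- x)) - 1 / (s + exp x)))"
    proof (rule Bochner_Integration.integrable_bound)
      show "integrable lborel (\<lambda>x. ?W x * (1 / s))"
        by (intro integrable_mult_left integrable_ml_weight \<alpha> c)
      show "AE x in lborel. norm (?W x * (1 / (s + exp (- x)) - 1 / (s + exp x))) \<le> norm (?W x * (1 / s))"
      proof (rule AE_I2)
        fix x
        have "1 / (s + exp (- x)) \<le> 1 / s" "1 / (s + exp x) \<le> 1 / s"
          "1 / (s + exp (- x)) \<ge> 0" "1 / (s + exp x) \<ge> 0"
          using s by (auto intro!: divide_left_mono mult_pos_pos add_pos_pos simp: add_nonneg_nonneg)
        then have "\<bar>1 / (s + exp (- x)) - 1 / (s + exp x)\<bar> \<le> \<bar>1 / s\<bar>"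
          by linarith
        then show "norm (?W x * (1 / (s + exp (- x)) - 1 / (s + exp x))) \<le> norm (?W x * (1 / s))"
          unfolding real_norm_def abs_mult[of "?W x"] by (rule mult_left_mono) simp
      qed
    qed measurable
    ultimately show "integrable lborel (\<lambda>x. \<integral>y. norm (case_prod ?f (x, y)) \<partial>lborel)"
      by simp
  qed
  have "(\<integral>x. ?f x y \<partial>lborel) = indicator {0<..} y *\<^sub>R exp (- (s * y)) *\<^sub>R ml_integral \<alpha> y" for y
  proof -
    have "(\<integral>x. ?f x y \<partial>lborel) = (\<integral>x. indicator {0<..} y * exp (- (s * y)) * (?W x * (exp (- (y * exp (- x))) - exp (- (y * exp x)))) \<partial>lborel)"
      by (intro Bochner_Integration.integral_cong) (auto simp: mult_ac)
    then show ?thesis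
      by (simp add: ml_integral_def mult.assoc)
  qed
  moreover have "integrable lborel (\<lambda>y. \<integral>x. ?f x y \<partial>lborel)"
    by (rule lborel_pair.integrable_snd[OF pair])
  moreover have "(\<integral>y. (\<integral>x. ?f x y \<partial>lborel) \<partial>lborel) = (\<integral>x. (\<integral>y. ?f x y \<partial>lborel) \<partial>lborel)"
    by (rule lborel_pair.Fubini_integral[OF pair])
  ultimately show ?thesis
    unfolding has_laplace_def has_bochner_integral_iff fi by (simp add: mult.assoc)
qed

text \<open>The imaginary part of the transform of \<open>exp (y * cis t)\<close>, which is the
  Mittag-Leffler function of order 1.\<close>

lemma has_laplace_exp_sin:
  assumes s: "s > 1"
  shows "has_laplace (\<lambda>y. exp (y * cos t) * sin (y * sin t)) s (Im (1 / (of_real s - cis t)))"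
proof -
  have "has_laplace (\<lambda>y. mittag_leffler 1 1 (cis t * of_real (y powr 1))) s
     (1 / (of_real s * (1 - cis t / of_real (s powr 1))))"
    by (rule has_laplace_mittag_leffler) (use s in auto)
  also have "1 / (of_real s * (1 - cis t / of_real (s powr 1))) = 1 / (of_real s - cis t)"
    using s by (simp add: right_diff_distrib)
  finally have "has_laplace (\<lambda>y. Im (mittag_leffler 1 1 (cis t * of_real (y powr 1)))) s (Im (1 / (of_real s - cis t)))"
    by (rule has_laplace_Im)
  then show ?thesis
    by (rule has_laplace_cong[THEN iffD1, rotated]) (simp add: mittag_leffler_1 Im_exp mult.commute)
qed

lemma has_laplace_Im_mittag_leffler:
  assumes \<alpha>: "0 < \<alpha>" and s: "s > 1"
  shows "has_laplace (\<lambda>y. Im (mittag_leffler \<alpha> 1 (\<i> * of_real (y powr \<alpha>)))) s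
    (s powr (\<alpha> - 1) / (s powr (2 * \<alpha>) + 1))"
proof -
  define a where "a = s powr \<alpha>"
  have a: "a > 0" using s by (simp add: a_def)
  have "norm \<i> < s powr \<alpha>"
    using \<alpha> s by (simp add: gr_one_powr)
  then have "has_laplace (\<lambda>y. Im (mittag_leffler \<alpha> 1 (\<i> * of_real (y powr \<alpha>)))) s
      (Im (1 / (of_real s * (1 - \<i> / of_real (s powr \<alpha>)))))"
    using \<alpha> s by (intro has_laplace_Im has_laplace_mittag_leffler) auto
  \<comment> \<open>Expand the fraction by the conjugate of \<open>a - \<i>\<close>, where
    \<open>a = s powr \<alpha>\<close>; only the imaginary part is kept.\<close>
  also have "1 / (of_real s * (1 - \<i> / of_real (s powr \<alpha>))) = Complex (a * a / (s * (a * a + 1))) (a / (s * (a * a + 1)))"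
  proof -
    have nz: "a * a + 1 \<noteq> 0" using a by (simp add: add_nonneg_eq_0_iff)
    have "of_real s * (1 - \<i> / of_real a) * Complex (a * a / (s * (a * a + 1))) (a / (s * (a * a + 1))) = 1"
      using a s nz by (simp add: complex_eq_iff Re_divide Im_divide power2_eq_square add_divide_distrib[symmetric] divide_simps) (simp add: algebra_simps)
    then show ?thesis
      unfolding a_def[symmetric] by (metis mult_zero_left nonzero_eq_divide_eq mult.commute zero_neq_one)
  qed
  also have "Im \<dots> = s powr (\<alpha> - 1) / (s powr (2 * \<alpha>) + 1)"
  proof -
    have "s powr (2 * \<alpha>) = a * a" by (simp add: a_def flip: powr_add)
    moreover have "s powr (\<alpha> - 1) = a / s" using s by (simp add: a_def powr_diff)
    ultimately show ?thesis by simp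
  qed
  finally show ?thesis .
qed

lemma ml_weight_stieltjes_integral:
  assumes \<alpha>: "0 < \<alpha>" "\<alpha> < 1" "\<alpha> \<noteq> 1/2" and s: "s > 1"
  shows "(\<integral>x. indicator {0<..} x * (ml_weight \<alpha> x * (1 / (s + exp (- x)) - 1 / (s + exp x))) \<partial>lborel)
    = 2 * pi / sin (pi * \<alpha>) * (s powr (\<alpha> - 1) / (s powr (2 * \<alpha>) + 1)
      - (if \<alpha> > 1/2 then Im (1 / (of_real s - cis (ml_pole \<alpha>))) / \<alpha> else 0))"
proof -
  let ?g = "\<lambda>x. ml_weight \<alpha> x * (1 / (s + exp (- x)) - 1 / (s + exp x))"
  have c: "cos (pi * \<alpha>) \<noteq> 0" by (rule cos_pi_mult_neq_0[OF \<alpha>])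
  have s_exp: "s + exp x \<noteq> 0" for x using s exp_gt_zero[of x] by linarith
  have cont: "continuous_on A ?g" for A
    using s_exp by (intro continuous_intros c) auto
  \<comment> \<open>The open and the closed half-line agree pointwise, because
    \<open>sinh 0 = 0\<close> makes the weight vanish at 0.\<close>
  have i0: "indicator {0<..} x * ?g x = indicator {0..} x *\<^sub>R ?g x" for x
    by (cases "x = 0") (auto simp: indicator_def ml_weight_def)
  have int: "set_integrable lborel {0..} ?g"
    unfolding set_integrable_def i0[symmetric]
  proof (rule Bochner_Integration.integrable_bound[OF integrable_ml_weight[OF \<alpha>(1) c]])
    show "AE x in lborel. norm (indicator {0<..} x * ?g x) \<le> norm (indicator {0<..} x * ml_weight \<alpha> x)"
    proof (rule AE_I2)
      fix x :: real
      have *: "0 < 1 / (s + exp r) \<and> 1 / (s + exp r) < 1" for r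
      proof -
        have "s + exp r > 1" using s exp_gt_zero[of r] by linarith
        then show ?thesis by simp
      qed
      have "\<bar>1 / (s + exp (- x)) - 1 / (s + exp x)\<bar> \<le> 1"
        using *[of x] *[of "- x"] by linarith
      then have "\<bar>ml_weight \<alpha> x\<bar> * \<bar>1 / (s + exp (- x)) - 1 / (s + exp x)\<bar> \<le> \<bar>ml_weight \<alpha> x\<bar> * 1"
        by (intro mult_left_mono) auto
      then show "norm (indicator {0<..} x * ?g x) \<le> norm (indicator {0<..} x * ml_weight \<alpha> x)"
        by (simp add: abs_mult indicator_def)
    qed
  qed measurable
  have "((\<lambda>N. set_lebesgue_integral lborel {0..N} ?g) \<longlongrightarrow> set_lebesgue_integral lborel {0..} ?g) at_top"
    by (rule tendsto_set_lebesgue_integral_at_top[OF _ int]) auto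
  moreover have "set_lebesgue_integral lborel {0..N} ?g = integral {0..N} ?g" for N
    by (rule set_borel_integral_eq_integral) (rule borel_integrable_atLeastAtMost'[OF cont])
  ultimately have "((\<lambda>N. integral {0..N} ?g) \<longlongrightarrow> set_lebesgue_integral lborel {0..} ?g) at_top"
    by simp
  then have "set_lebesgue_integral lborel {0..} ?g = 2 * pi / sin (pi * \<alpha>) * (s powr (\<alpha> - 1) / (s powr (2 * \<alpha>) + 1)
      - (if \<alpha> > 1/2 then Im (1 / (of_real s - cis (ml_pole \<alpha>))) / \<alpha> else 0))"
    using ml_weight_stieltjes[OF \<alpha> s] by (rule tendsto_unique[rotated]) simp
  then show ?thesis
    unfolding set_lebesgue_integral_def i0 .
qed

text \<open>The difference \<open>u\<close> of the two sides is continuous, grows at most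
  exponentially and has zero transform, since the Stieltjes identity was solved for exactly this
  combination.\<close>

lemma Im_mittag_leffler_eq:
  assumes \<alpha>: "0 < \<alpha>" "\<alpha> < 1" "\<alpha> \<noteq> 1/2" and y: "y > 0"
  shows "Im (mittag_leffler \<alpha> 1 (\<i> * of_real (y powr \<alpha>))) =
    (if \<alpha> > 1/2 then exp (y * cos (ml_pole \<alpha>)) * sin (y * sin (ml_pole \<alpha>)) / \<alpha> else 0)
      + sin (pi * \<alpha>) / (2 * pi) * ml_integral \<alpha> y"
proof -
  let ?t = "ml_pole \<alpha>"
  define k where "k = (if \<alpha> > 1/2 then 1 / \<alpha> else 0)"
  define m where "m = sin (pi * \<alpha>) / (2 * pi)"
  define u where "u = (\<lambda>y. Im (mittag_leffler \<alpha> 1 (\<i> * of_real (y powr \<alpha>)))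
    - k * (exp (y * cos ?t) * sin (y * sin ?t)) - m * ml_integral \<alpha> y)"
  have c: "cos (pi * \<alpha>) \<noteq> 0" by (rule cos_pi_mult_neq_0[OF \<alpha>])
  have sn: "sin (pi * \<alpha>) > 0" using \<alpha> by (intro sin_gt_zero) auto
  define K where "K = (\<integral>x. indicator {0<..} x * ml_weight \<alpha> x \<partial>lborel)"
  \<comment> \<open>With this value \<open>(2 * y powr \<alpha>) powr (1/\<alpha>) = b * y\<close>,
    the exponent in \<open>norm_mittag_leffler_le\<close>. As \<open>b \<ge> 1\<close>, the same
    exponential also dominates the other two terms.\<close>
  define b where "b = 2 powr (1/\<alpha>)"
  have b: "b \<ge> 1" using \<alpha> by (simp add: b_def ge_one_powr_ge_zero)
  have K: "K \<ge> 0" using abs_ml_integral_le[OF \<alpha>(1) c, of 0] by (simp add: K_def)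
  have km: "k \<ge> 0" "m \<ge> 0" using \<alpha> sn by (auto simp: k_def m_def)
  have "u y = 0"
  proof (rule has_laplace_zero_imp_zero[OF _ _ _ y])
    have "continuous_on UNIV (mittag_leffler \<alpha> 1)"
      by (intro holomorphic_on_imp_continuous_on holomorphic_mittag_leffler \<alpha>)
    moreover have "continuous_on {0..} (\<lambda>y::real. y powr \<alpha>)"
      by (rule continuous_on_powr') (use \<alpha> in auto)
    then have "continuous_on {0..} (\<lambda>y. \<i> * complex_of_real (y powr \<alpha>))"
      by (rule continuous_on_mult[OF continuous_on_const continuous_on_of_real])
    ultimately have "continuous_on {0..} (\<lambda>y. mittag_leffler \<alpha> 1 (\<i> * of_real (y powr \<alpha>)))"
      by (rule continuous_on_compose2) auto
    then show "continuous_on {0..} u"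
      unfolding u_def by (intro continuous_intros continuous_on_ml_integral \<alpha> c)
    show "\<bar>u y\<bar> \<le> (2 + k + m * K) * exp (b * y)" if y: "y \<ge> 0" for y
    proof -
      have e: "exp (b * y) \<ge> 1" using b y by simp
      have "\<bar>Im (mittag_leffler \<alpha> 1 (\<i> * of_real (y powr \<alpha>)))\<bar> \<le> 2 * exp (b * y)"
      proof -
        have "(2 * norm (\<i> * complex_of_real (y powr \<alpha>))) powr (1/\<alpha>) = b * y"
          using y \<alpha> by (simp add: norm_mult powr_mult powr_powr b_def)
        then show ?thesis
          using norm_mittag_leffler_le[OF \<alpha>(1), of "\<i> * of_real (y powr \<alpha>)"] abs_Im_le_cmod order_trans by metis
      qed
      moreover have "\<bar>k * (exp (y * cos ?t) * sin (y * sin ?t))\<bar> \<le> k * exp (b * y)"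
      proof -
        have "y * cos ?t \<le> y * b" using y b cos_le_one[of ?t] by (intro mult_left_mono) linarith+
        then have "exp (y * cos ?t) * \<bar>sin (y * sin ?t)\<bar> \<le> exp (b * y) * 1"
          by (intro mult_mono) (auto simp: mult.commute)
        then show ?thesis using km by (simp add: abs_mult mult_left_mono)
      qed
      moreover have "\<bar>m * ml_integral \<alpha> y\<bar> \<le> m * K * exp (b * y)"
      proof -
        have "\<bar>m * ml_integral \<alpha> y\<bar> \<le> m * K"
          using abs_ml_integral_le[OF \<alpha>(1) c y] km by (simp add: abs_mult mult_left_mono K_def)
        also have "\<dots> * 1 \<le> m * K * exp (b * y)"
          using e K km by (intro mult_left_mono) auto
        finally show ?thesis by simp
      qed
      moreover have "(2 + k + m * K) * exp (b * y) = 2 * exp (b * y) + k * exp (b * y) + m * K * exp (b * y)"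
        by (simp add: algebra_simps)
      ultimately show ?thesis
        unfolding u_def by linarith
    qed
    \<comment> \<open>The transforms are known for \<open>s > 1\<close>, and uniqueness needs a
      closed half-line of values; any start above 1 would serve.\<close>
    show "has_laplace u s 0" if s: "s \<ge> 2" for s
    proof -
      have s1: "s > 1" using s by simp
      have "has_laplace u s (s powr (\<alpha> - 1) / (s powr (2 * \<alpha>) + 1) - k * Im (1 / (of_real s - cis ?t))
          - m * (2 * pi / sin (pi * \<alpha>) * (s powr (\<alpha> - 1) / (s powr (2 * \<alpha>) + 1)
      - (if \<alpha> > 1/2 then Im (1 / (of_real s - cis (ml_pole \<alpha>))) / \<alpha> else 0))))"
        unfolding u_def ml_weight_stieltjes_integral[OF \<alpha> s1, symmetric]
        using s1
        by (intro has_laplace_diff has_laplace_mult has_laplace_exp_sin has_laplace_Im_mittag_leffler has_laplace_ml_integral \<alpha> c)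
           auto
      also have "m * (2 * pi / sin (pi * \<alpha>) * x) = x" for x
        using sn by (simp add: m_def)
      finally show ?thesis
        by (simp add: k_def split: if_splits)
    qed
  qed
  then show ?thesis
    by (simp add: u_def k_def m_def split: if_splits)
qed

subsection \<open>Positivity\<close>

text \<open>The integrand is strictly positive for \<open>x > 0\<close>, so a zero integral would
  make the unit interval a null set.\<close>

lemma ml_integral_pos:
  assumes \<alpha>: "0 < \<alpha>" and c: "cos (pi * \<alpha>) \<noteq> 0" and y: "y > 0"
  shows "ml_integral \<alpha> y > 0"
proof -
  let ?f = "\<lambda>x. indicator {0<..} x * ml_weight \<alpha> x * (exp (- (y * exp (- x))) - exp (- (y * exp x)))"
  have pos: "?f x > 0" if "x > 0" for x
  proof -
    have "y * exp (- x) < y * exp x" using that y by simp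
    then show ?thesis using ml_weight_pos[OF \<alpha> that] that by simp
  qed
  have nonneg: "?f x \<ge> 0" for x
    using pos[of x] by (cases "x > 0") auto
  have "integral\<^sup>L lborel ?f \<noteq> 0"
  proof
    assume "integral\<^sup>L lborel ?f = 0"
    then have "AE x in lborel. ?f x = 0"
      using integrable_ml_integrand[OF \<alpha> c, of y] y nonneg by (subst (asm) integral_nonneg_eq_0_iff_AE) auto
    then have "AE x in lborel. x \<notin> {0<..<1::real}"
    proof (rule eventually_mono)
      fix x assume "?f x = 0"
      then show "x \<notin> {0<..<1::real}" using pos[of x] by auto
    qed
    then have "{0<..<1::real} \<in> null_sets lborel"
      by (subst (asm) AE_iff_null_sets[symmetric]) auto
    then show False by (auto simp: null_sets_def)
  qed
  moreover have "integral\<^sup>L lborel ?f \<ge> 0"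
    by (rule integral_nonneg_AE) (use nonneg in auto)
  ultimately show ?thesis
    unfolding ml_integral_def by linarith
qed

section \<open>Quantitative lower bounds\<close>

lemma has_bochner_integral_exp_minus_tail:
  assumes r: "r > 0"
  shows "has_bochner_integral lborel (\<lambda>x. indicator {a<..} x * exp (- (r * x))) (exp (- (r * a)) / r :: real)"
proof -
  have "has_bochner_integral lborel (\<lambda>x. indicator {0<..} (- a + 1 * x) * exp (- (r * (- a + 1 * x)))) (1 / r /\<^sub>R \<bar>1\<bar>)"
    using has_bochner_integral_exp_minus[OF r]
    by (subst (asm) lborel_has_bochner_integral_real_affine_iff[of 1 _ _ "- a"]) auto
  then have "has_bochner_integral lborel (\<lambda>x. exp (- (r * a)) * (indicator {0<..} (- a + 1 * x) * exp (- (r * (- a + 1 * x))))) (exp (- (r * a)) * (1 / r /\<^sub>R \<bar>1\<bar>))"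
    by (intro has_bochner_integral_mult_right)
  moreover have "exp (- (r * a)) * (indicator {0<..} (- a + 1 * x) * exp (- (r * (- a + 1 * x)))) = indicator {a<..} x * exp (- (r * x))" for x
    by (auto simp: indicator_def exp_add[symmetric] algebra_simps)
  ultimately show ?thesis by simp
qed

text \<open>The denominator is at most \<open>(cosh a)\<^sup>2\<close> because the squared cosine is
  at most 1. With \<open>u = exp (2 * a)\<close>, the claim
  \<open>(cosh a)\<^sup>2 \<le> exp a * sinh a\<close> becomes \<open>u \<ge> 4 + 1 / u\<close>, for
  which \<open>u \<ge> 6\<close> is ample; this follows from \<open>2 * \<alpha> \<ge> 1\<close> and
  \<open>exp x \<ge> 6\<close>.\<close>

lemma ml_weight_ge:
  assumes \<alpha>: "\<alpha> \<ge> 1/2" and x: "exp x \<ge> 6"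
  shows "ml_weight \<alpha> x \<ge> exp (- (\<alpha> * x))"
proof -
  define a where "a = \<alpha> * x"
  have x0: "x > 0"
  proof (rule ccontr)
    assume "\<not> x > 0"
    then have "exp x \<le> 1" by simp
    then show False using x by linarith
  qed
  have "x \<le> 2 * a" using mult_right_mono[OF \<alpha>, of x] x0 by (simp add: a_def)
  then have "exp x \<le> exp (2 * a)" by simp
  then have E: "exp (2 * a) \<ge> 6" using x by linarith
  define e where "e = exp a"
  have ea: "exp (- a) = 1 / e"
    unfolding e_def exp_minus by (rule inverse_eq_divide)
  have e: "e > 0" "e\<^sup>2 \<ge> 6" using E unfolding exp_double e_def by simp_all
  have le: "(sinh a)\<^sup>2 + (cos (pi * \<alpha>))\<^sup>2 \<le> (cosh a)\<^sup>2"
    unfolding cosh_square_eq using abs_cos_le_one[of "pi * \<alpha>"] by (simp add: abs_square_le_1)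
  have sa: "sinh a > 0" using \<alpha> x0 by (simp add: a_def)
  then have D: "0 < (sinh a)\<^sup>2 + (cos (pi * \<alpha>))\<^sup>2"
    by (intro add_pos_nonneg) auto
  have w1: "sinh a / (cosh a)\<^sup>2 \<le> sinh a / ((sinh a)\<^sup>2 + (cos (pi * \<alpha>))\<^sup>2)"
    by (rule divide_left_mono[OF le less_imp_le[OF sa] mult_pos_pos[OF less_le_trans[OF D le] D]])
  have w2: "1 / e \<le> sinh a / (cosh a)\<^sup>2"
  proof -
    define i where "i = 1 / e"
    have ei: "e * i = 1" using e by (simp add: i_def)
    have sh: "sinh a = (e - i) / 2" "cosh a = (e + i) / 2"
      unfolding sinh_field_def cosh_field_def ea e_def[symmetric] i_def by (rule refl)+
    have "6 * i\<^sup>2 \<le> e\<^sup>2 * i\<^sup>2"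
      using e by (intro mult_right_mono) auto
    also have "e\<^sup>2 * i\<^sup>2 = 1"
      by (simp only: power_mult_distrib[symmetric] ei power_one)
    finally have q: "6 * i\<^sup>2 \<le> 1" .
    have 1: "(cosh a)\<^sup>2 = (e\<^sup>2 + 2 + i\<^sup>2) / 4"
      unfolding sh power_divide power2_sum mult.assoc ei by simp
    have "e * sinh a = (e * e - e * i) / 2"
      unfolding sh by (simp add: right_diff_distrib)
    then have 2: "e * sinh a = (e\<^sup>2 - 1) / 2"
      by (simp only: ei power2_eq_square)
    have "(cosh a)\<^sup>2 \<le> e * sinh a"
    proof -
      have "(u + 2 + v) / 4 \<le> (u - 1) / 2" if "6 \<le> u" "6 * v \<le> 1" for u v :: real
        using that by (simp add: field_simps)
      from this[OF e(2) q] show ?thesis unfolding 1 2 .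
    qed
    moreover have "1 / e \<le> v / w" if "w \<le> e * v" "0 < w" for v w
      using that e(1) by (simp add: field_simps)
    ultimately show ?thesis
      using less_le_trans[OF D le] by blast
  qed
  show ?thesis
    unfolding ml_weight_def a_def[symmetric] ea using order_trans[OF w2 w1] by (simp only:)
qed

text \<open>Keep only \<open>x > ln y\<close>. There \<open>exp x \<ge> y\<close>, so the bracket is
  at least \<open>exp (- 1) - exp (- (y * y))\<close> and the weight at least
  \<open>exp (- (\<alpha> * x))\<close>. The tail integral is
  \<open>y powr (- \<alpha>) / \<alpha>\<close>, which is at least
  \<open>1 / (\<alpha> * y)\<close>.\<close>

lemma ml_integral_ge:
  assumes \<alpha>: "1/2 < \<alpha>" "\<alpha> < 1" and y: "y \<ge> 6"
  shows "ml_integral \<alpha> y \<ge> 9 / 25 / (\<alpha> * y)"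
proof -
  let ?f = "\<lambda>x. indicator {0<..} x * ml_weight \<alpha> x * (exp (- (y * exp (- x))) - exp (- (y * exp x)))"
  have \<alpha>0: "\<alpha> > 0" using \<alpha> by simp
  have c: "cos (pi * \<alpha>) \<noteq> 0" by (rule cos_pi_mult_neq_0) (use \<alpha> in auto)
  have T: "has_bochner_integral lborel (\<lambda>x. 9 / 25 * (indicator {ln y<..} x * exp (- (\<alpha> * x)))) (9 / 25 * (exp (- (\<alpha> * ln y)) / \<alpha>))"
    by (intro has_bochner_integral_mult_right has_bochner_integral_exp_minus_tail \<alpha>0)
  \<comment> \<open>Numerically \<open>100 / 272 - 1 / 600\<close> is about 0.366, slightly above
    9/25 = 0.36.\<close>
  have gap: "exp (- 1) - exp (- (y * y)) \<ge> (9 / 25 :: real)"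
  proof -
    have 1: "exp (- 1) \<ge> (100 / 272 :: real)"
      using e_less_272 by (simp add: exp_minus field_simps)
    have "y * y \<ge> 6 * 6" using y by (intro mult_mono) auto
    then have 2: "exp (- (y * y)) \<le> exp (- 36)" by simp
    have "exp (36::real) \<ge> 1 + 36 + 36\<^sup>2 / 2"
      by (rule exp_lower_Taylor_quadratic) simp
    then have "exp (- 36) \<le> (1 / 600 :: real)"
      by (simp add: exp_minus field_simps)
    with 1 2 show ?thesis by linarith
  qed
  have "9 / 25 * (exp (- (\<alpha> * ln y)) / \<alpha>) \<le> ml_integral \<alpha> y"
    unfolding ml_integral_def has_bochner_integral_integral_eq[OF T, symmetric]
  proof (rule integral_mono)
    show "integrable lborel (\<lambda>x. 9 / 25 * (indicator {ln y<..} x * exp (- (\<alpha> * x))))"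
      using T by (simp add: has_bochner_integral_iff)
    show "integrable lborel ?f"
      by (rule integrable_ml_integrand[OF \<alpha>0 c]) (use y in simp)
    fix x :: real
    show "9 / 25 * (indicator {ln y<..} x * exp (- (\<alpha> * x))) \<le> ?f x"
    proof (cases "x > ln y")
      case True
      have x0: "x > 0" using True y ln_gt_zero[of y] by linarith
      have "exp (ln y) \<le> exp x" using True by simp
      then have ex: "exp x \<ge> y" using y by simp
      have "exp (- 1) \<le> exp (- (y * exp (- x)))"
        using ex y by (simp add: exp_minus field_simps)
      moreover have "exp (- (y * exp x)) \<le> exp (- (y * y))"
        using ex y by simp
      ultimately have b: "9 / 25 \<le> exp (- (y * exp (- x))) - exp (- (y * exp x))"
        using gap by linarith
      have w: "exp (- (\<alpha> * x)) \<le> ml_weight \<alpha> x"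
        by (rule ml_weight_ge) (use \<alpha> ex y in auto)
      have "exp (- (\<alpha> * x)) * (9 / 25) \<le> ml_weight \<alpha> x * (exp (- (y * exp (- x))) - exp (- (y * exp x)))"
        using w b ml_weight_pos[OF \<alpha>0 x0] by (intro mult_mono) auto
      then show ?thesis using True x0 by simp
    next
      case False
      then show ?thesis
        using ml_bracket(1)[of y x] ml_weight_pos[OF \<alpha>0, of x] y by (cases "x > 0") auto
    qed
  qed
  moreover have "exp (- (\<alpha> * ln y)) \<ge> 1 / y"
  proof -
    have "\<alpha> * ln y \<le> 1 * ln y" using \<alpha> y by (intro mult_right_mono) auto
    then have "exp (- (\<alpha> * ln y)) \<ge> exp (- ln y)" by simp
    then show ?thesis using y by (simp add: exp_minus divide_inverse)
  qed
  then have "9 / 25 * (1 / y / \<alpha>) \<le> 9 / 25 * (exp (- (\<alpha> * ln y)) / \<alpha>)"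
    using \<alpha> by (intro mult_left_mono divide_right_mono) auto
  ultimately show ?thesis by (simp add: mult.commute)
qed

text \<open>The sine in the pole term is bounded below by -1. Multiplying by \<alpha> clears the
  factor \<open>1 / \<alpha>\<close> from both terms.\<close>

lemma Im_mittag_leffler_ge:
  assumes \<alpha>: "1/2 < \<alpha>" "\<alpha> < 1" and y: "y \<ge> 6"
  shows "\<alpha> * Im (mittag_leffler \<alpha> 1 (\<i> * of_real (y powr \<alpha>))) \<ge>
    sin (pi * \<alpha>) / (2 * pi) * (9 / 25) / y - exp (y * cos (ml_pole \<alpha>))"
proof -
  have sn: "sin (pi * \<alpha>) > 0" using \<alpha> by (intro sin_gt_zero) auto
  have "\<alpha> * Im (mittag_leffler \<alpha> 1 (\<i> * of_real (y powr \<alpha>))) =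
      exp (y * cos (ml_pole \<alpha>)) * sin (y * sin (ml_pole \<alpha>)) + sin (pi * \<alpha>) / (2 * pi) * (\<alpha> * ml_integral \<alpha> y)"
    using Im_mittag_leffler_eq[of \<alpha> y] \<alpha> y by (simp add: distrib_left)
  moreover have "exp (y * cos (ml_pole \<alpha>)) * sin (y * sin (ml_pole \<alpha>)) \<ge> exp (y * cos (ml_pole \<alpha>)) * (- 1)"
    by (intro mult_left_mono) auto
  moreover have "sin (pi * \<alpha>) / (2 * pi) * (\<alpha> * ml_integral \<alpha> y) \<ge> sin (pi * \<alpha>) / (2 * pi) * (9 / 25 / y)"
  proof (rule mult_left_mono)
    have "\<alpha> * (9 / 25 / (\<alpha> * y)) \<le> \<alpha> * ml_integral \<alpha> y"
      using ml_integral_ge[OF assms] \<alpha> by (intro mult_left_mono) auto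
    then show "9 / 25 / y \<le> \<alpha> * ml_integral \<alpha> y" using \<alpha> by simp
  qed (use sn in simp)
  ultimately show ?thesis by simp
qed

lemma ml_pole_bounds:
  assumes "1/2 < \<alpha>" "\<alpha> < 1"
  shows "pi / 2 < ml_pole \<alpha>" "ml_pole \<alpha> < pi"
  using assms by (auto simp: ml_pole_def field_simps)

lemma Im_mittag_leffler_pos_large:
  assumes \<alpha>: "1/2 < \<alpha>" "\<alpha> < 1"
  obtains Y where "Y > 0" "\<And>y. y \<ge> Y \<Longrightarrow> Im (mittag_leffler \<alpha> 1 (\<i> * of_real (y powr \<alpha>))) > 0"
proof
  define c k where "c = - cos (ml_pole \<alpha>)" and "k = sin (pi * \<alpha>) / (2 * pi) * (9 / 25)"
  have c: "c > 0"
    using ml_pole_bounds[OF \<alpha>] cos_monotone_0_pi[of "pi/2" "ml_pole \<alpha>"] by (simp add: c_def)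
  have "sin (pi * \<alpha>) > 0" using \<alpha> by (intro sin_gt_zero) auto
  then have k: "k > 0" by (simp add: k_def)
  \<comment> \<open>The 6 is the range of \<open>ml_integral_ge\<close>. The other bound makes
    \<open>y \<le> k * (c * y)\<^sup>2 / 2\<close>, which is below \<open>k * exp (c * y)\<close>;
    hence the pole term is smaller than \<open>k / y\<close>.\<close>
  show "max 6 (2 / (k * c\<^sup>2)) > 0" by simp
  fix y assume y: "y \<ge> max 6 (2 / (k * c\<^sup>2))"
  then have y6: "y \<ge> 6" and y2: "2 \<le> k * c\<^sup>2 * y"
    using k c by (auto simp: field_simps)
  have "exp (c * y) \<ge> 1 + c * y + (c * y)\<^sup>2 / 2"
    using c y6 by (intro exp_lower_Taylor_quadratic) auto
  moreover have "c * y > 0" using c y6 by simp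
  ultimately have "exp (c * y) > (c * y)\<^sup>2 / 2" by linarith
  then have "k * ((c * y)\<^sup>2 / 2) < k * exp (c * y)" using k by simp
  moreover have "2 * y \<le> k * c\<^sup>2 * y * y"
    using y2 y6 by (intro mult_right_mono) auto
  then have "y \<le> k * ((c * y)\<^sup>2 / 2)"
    by (simp add: power_mult_distrib power2_eq_square mult_ac)
  ultimately have "y < k * exp (c * y)" by linarith
  then have "exp (- (c * y)) < k / y"
    using y6 by (simp add: exp_minus field_simps)
  moreover have "\<alpha> * Im (mittag_leffler \<alpha> 1 (\<i> * of_real (y powr \<alpha>))) \<ge> k / y - exp (- (c * y))"
    using Im_mittag_leffler_ge[OF \<alpha> y6] by (simp add: k_def c_def mult.commute)
  ultimately have "\<alpha> * Im (mittag_leffler \<alpha> 1 (\<i> * of_real (y powr \<alpha>))) > 0" by linarith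
  then show "Im (mittag_leffler \<alpha> 1 (\<i> * of_real (y powr \<alpha>))) > 0"
    using \<alpha> by (simp add: zero_less_mult_iff)
qed

lemma Im_mittag_leffler_pos:
  assumes \<alpha>: "0 < \<alpha>" "\<alpha> \<le> 3/5" "\<alpha> \<noteq> 1/2" and y: "y > 0"
  shows "Im (mittag_leffler \<alpha> 1 (\<i> * of_real (y powr \<alpha>))) > 0"
proof -
  let ?t = "ml_pole \<alpha>"
  have c: "cos (pi * \<alpha>) \<noteq> 0" by (rule cos_pi_mult_neq_0) (use \<alpha> in auto)
  have sn: "sin (pi * \<alpha>) > 0" using \<alpha> by (intro sin_gt_zero) auto
  have I: "sin (pi * \<alpha>) / (2 * pi) * ml_integral \<alpha> y > 0"
    using ml_integral_pos[OF \<alpha>(1) c y] sn by (intro mult_pos_pos divide_pos_pos) auto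
  note eq = Im_mittag_leffler_eq[OF \<alpha>(1) _ \<alpha>(3) y]
  show ?thesis
  proof (cases "\<alpha> > 1/2")
    case False
    then show ?thesis using eq I \<alpha> by simp
  next
    case True
    have "\<alpha> < 1" using \<alpha> by simp
    note t = ml_pole_bounds[OF True this]
    have st: "sin ?t > 0" using t \<alpha> by (intro sin_gt_zero) auto
    show ?thesis
    proof (cases "y * sin ?t \<le> pi")
      case le: True
      have "sin (y * sin ?t) \<ge> 0"
        using le y st by (intro sin_ge_zero) auto
      then have "exp (y * cos ?t) * sin (y * sin ?t) / \<alpha> \<ge> 0"
        using \<alpha> by simp
      then show ?thesis using eq I \<alpha> True by simp
    next
      case False
      \<comment> \<open>This is where \<open>\<alpha> \<le> 3/5\<close> enters: the angle is within
        \<open>pi / 6\<close> of \<open>pi\<close>, so its sine is at most 1/2 and the first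
        half-wave of the pole term lasts until \<open>y = 2 * pi\<close> at least.\<close>
      have t5: "pi - ?t \<le> pi / 6" "pi - ?t \<ge> 0"
        using \<alpha> True t by (auto simp: ml_pole_def field_simps)
      have "sin ?t \<le> 1 / 2"
        using sin_monotone_2pi_le[of "pi - ?t" "pi / 6"] t5 by (simp add: sin_30)
      then have "y * sin ?t \<le> y * (1 / 2)" using y by (intro mult_left_mono) auto
      then have y2: "y \<ge> 2 * pi" using False by linarith
      then have y6: "y \<ge> 6" using pi_gt3 by linarith
      \<comment> \<open>433/500 = 0.866 is a rational lower bound used both for the decay rate
        \<open>- cos ?t\<close> and for \<open>sin (pi * \<alpha>)\<close>.\<close>
      have sqrt3: "sqrt 3 / 2 \<ge> (433 / 500 :: real)"
      proof -
        have "433 / 250 \<le> sqrt (3 :: real)"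
          by (rule real_le_rsqrt) (simp add: power2_eq_square)
        then show ?thesis by simp
      qed
      have "cos (pi - ?t) \<ge> sqrt 3 / 2"
        using cos_monotone_0_pi_le[of "pi - ?t" "pi / 6"] t5 by (simp add: cos_30)
      then have ct: "cos ?t \<le> - (433 / 500)" using sqrt3 by simp
      have "sin (pi * \<alpha>) \<ge> sqrt 3 / 2"
      proof -
        have "pi * \<alpha> - pi / 2 \<le> pi / 6" "0 \<le> pi * \<alpha> - pi / 2"
          using \<alpha> True pi_gt_zero mult_left_mono[of \<alpha> "3/5" pi] mult_left_mono[of "1/2" \<alpha> pi] by auto
        then have "cos (pi * \<alpha> - pi / 2) \<ge> sqrt 3 / 2"
          using cos_monotone_0_pi_le[of "pi * \<alpha> - pi / 2" "pi / 6"] by (simp add: cos_30)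
        then show ?thesis by (simp add: cos_diff)
      qed
      then have sa: "sin (pi * \<alpha>) \<ge> 433 / 500" using sqrt3 by simp
      define z where "z = 433 / 500 * y"
      have z: "z \<ge> 5" using y6 by (simp add: z_def)
      have "exp (1::real) \<ge> 27 / 10"
      proof -
        have "\<bar>exp 1 - 5837465777 / 2147483648\<bar> \<le> (1 / 100 :: real)"
          by (rule order_trans[OF e_approx_32]) simp
        from abs_le_D2[OF this] show ?thesis by linarith
      qed
      then have "exp (1::real) ^ 5 \<ge> (27 / 10) ^ 5"
        by (intro power_mono) auto
      then have e5: "exp (5::real) \<ge> 140"
        by (simp add: exp_of_nat_mult[symmetric] power_divide)
      \<comment> \<open>A linear lower bound for exp from \<open>z = 5\<close> on, with 140 below
        2.7 to the fifth power, about 143.5.\<close>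
      have "exp z = exp 5 * exp (z - 5)" by (simp flip: exp_add)
      also have "\<dots> \<ge> 140 * (1 + (z - 5))"
        using z e5 exp_ge_add_one_self[of "z - 5"] by (intro mult_mono) auto
      finally have ez: "exp z \<ge> 140 * z - 560" by simp
      have "exp (y * cos ?t) \<le> exp (- z)"
        using mult_left_mono[OF ct, of y] y by (simp add: z_def)
      moreover have "exp (- z) < sin (pi * \<alpha>) / (2 * pi) * (9 / 25) / y"
      proof -
        \<comment> \<open>After clearing denominators, the linear bound \<open>ez\<close> gives
          about \<open>37.8 * y - 174.6\<close> on the right, which exceeds \<open>6.3 * y\<close>
          for \<open>y \<ge> 6\<close>.\<close>
        have "2 * pi * y < 63 / 10 * y" using pi_less_4 y pi_approx by simp
        also have "\<dots> \<le> 433 / 500 * (9 / 25) * exp z" using ez y6 by (simp add: z_def)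
        also have "\<dots> \<le> sin (pi * \<alpha>) * (9 / 25) * exp z" using sa by simp
        finally show ?thesis
          using y by (simp add: exp_minus field_simps)
      qed
      ultimately have "\<alpha> * Im (mittag_leffler \<alpha> 1 (\<i> * of_real (y powr \<alpha>))) > 0"
        using Im_mittag_leffler_ge[OF True \<open>\<alpha> < 1\<close> y6] by linarith
      then show ?thesis using \<alpha> by (simp add: zero_less_mult_iff)
    qed
  qed
qed

text \<open>Odd powers of \<open>\<i> * t\<close> are imaginary and drop out. For
  \<open>n = 2 * k\<close> the denominator is \<open>Gamma (k + 1) = fact k\<close>, so the even
  terms form the exponential series.\<close>

lemma Re_mittag_leffler_half: "Re (mittag_leffler (1/2) 1 (\<i> * of_real t)) = exp (- t\<^sup>2)"
proof -
  let ?a = "\<lambda>n. Re ((\<i> * of_real t) ^ n / complex_of_real (Gamma (1/2 * real n + 1)))"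
  have 1: "?a sums Re (mittag_leffler (1/2) 1 (\<i> * of_real t))"
    by (intro sums_Re mittag_leffler_sums) simp
  have odd: "?a n = 0" if "n \<notin> range (\<lambda>k. 2 * k)" for n
  proof -
    have "odd n" using that by (auto elim!: evenE)
    then obtain k where "n = 2 * k + 1" by (elim oddE)
    moreover have "(\<i> * complex_of_real t) ^ (2 * k + 1) = \<i> * of_real ((- t\<^sup>2) ^ k * t)"
      by (simp add: power_mult power_mult_distrib)
    ultimately show ?thesis
      by (simp only: Re_divide_of_real) simp
  qed
  have even: "?a (2 * k) = (- t\<^sup>2) ^ k /\<^sub>R fact k" for k
  proof -
    have "(\<i> * complex_of_real t) ^ (2 * k) = of_real ((- t\<^sup>2) ^ k)"
      by (simp add: power_mult power_mult_distrib)
    moreover have "Gamma (1/2 * real (2 * k) + 1) = fact k"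
    proof -
      have "1/2 * real (2 * k) + 1 = 1 + real k" by simp
      then show ?thesis by (simp only: Gamma_fact)
    qed
    ultimately show ?thesis
      by (simp only: Re_divide_of_real Re_complex_of_real)
         (simp only: real_scaleR_def divide_inverse mult.commute)
  qed
  have "(\<lambda>k. ?a (2 * k)) sums exp (- t\<^sup>2)"
    unfolding even by (rule exp_converges)
  then have 2: "?a sums exp (- t\<^sup>2)"
    using sums_mono_reindex[of "\<lambda>k. 2 * k" ?a "exp (- t\<^sup>2)"] odd
    by (simp add: strict_mono_def)
  show ?thesis
    by (rule sums_unique2[OF 1 2])
qed

section \<open>Zeros on the imaginary axis\<close>

lemma mittag_leffler_imaginary_abs:
  assumes "\<alpha> > 0"
  shows "mittag_leffler \<alpha> 1 (\<i> * of_real t) = 0 \<longleftrightarrow> mittag_leffler \<alpha> 1 (\<i> * of_real \<bar>t\<bar>) = 0"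
proof (cases "t \<ge> 0")
  case False
  then have *: "\<i> * of_real t = cnj (\<i> * of_real \<bar>t\<bar>)" by (simp add: complex_eq_iff)
  show ?thesis unfolding * mittag_leffler_cnj[OF assms] by simp
qed simp

text \<open>Positivity of the imaginary part for large arguments, extended to negative
  \<open>t\<close> by conjugation, confines the zeros to a closed disc, where a nonconstant entire
  function has only finitely many. It is nonconstant because its value at 0 is the real number 1,
  whereas its value at \<open>\<i> * T\<close> is not real.\<close>

lemma finite_mittag_leffler_imaginary_zeros:
  assumes \<alpha>: "1/2 < \<alpha>" "\<alpha> < 1"
  shows "finite {t. mittag_leffler \<alpha> 1 (\<i> * of_real t) = 0}"
proof -
  have \<alpha>0: "\<alpha> > 0" using \<alpha> by simp
  obtain Y where Y: "Y > 0" "\<And>y. y \<ge> Y \<Longrightarrow> Im (mittag_leffler \<alpha> 1 (\<i> * of_real (y powr \<alpha>))) > 0"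
    by (rule Im_mittag_leffler_pos_large[OF \<alpha>]) blast
  define T where "T = Y powr \<alpha>"
  have large: "Im (mittag_leffler \<alpha> 1 (\<i> * of_real t)) > 0" if "t \<ge> T" for t
  proof -
    have T: "T > 0" using Y by (simp add: T_def)
    have "T powr (1/\<alpha>) \<le> t powr (1/\<alpha>)" using that T \<alpha>0 by (intro powr_mono2) auto
    then have "t powr (1/\<alpha>) \<ge> Y" using Y \<alpha>0 by (simp add: T_def powr_powr)
    from Y(2)[OF this] show ?thesis using that T \<alpha>0 by (simp add: powr_powr)
  qed
  have nc: "\<not> mittag_leffler \<alpha> 1 constant_on UNIV"
  proof
    assume "mittag_leffler \<alpha> 1 constant_on UNIV"
    then have "mittag_leffler \<alpha> 1 (\<i> * of_real T) = mittag_leffler \<alpha> 1 0"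
      unfolding constant_on_def by auto
    then show False using large[of T] mittag_leffler_0[OF \<alpha>0] by simp
  qed
  have "finite {z \<in> cball 0 T. mittag_leffler \<alpha> 1 z = 0}"
    by (rule holomorphic_compact_finite_zeros[OF holomorphic_mittag_leffler[OF \<alpha>0] _ _ _ _ nc]) auto
  moreover have "(\<lambda>t. \<i> * complex_of_real t) ` {t. mittag_leffler \<alpha> 1 (\<i> * of_real t) = 0} \<subseteq> {z \<in> cball 0 T. mittag_leffler \<alpha> 1 z = 0}"
  proof (rule image_subsetI)
    fix t :: real assume "t \<in> {t. mittag_leffler \<alpha> 1 (\<i> * of_real t) = 0}"
    then have z: "mittag_leffler \<alpha> 1 (\<i> * of_real t) = 0" by simp
    then have z': "mittag_leffler \<alpha> 1 (\<i> * of_real \<bar>t\<bar>) = 0"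
      using mittag_leffler_imaginary_abs[OF \<alpha>0] by blast
    have "\<bar>t\<bar> \<le> T"
    proof (rule ccontr)
      assume "\<not> \<bar>t\<bar> \<le> T"
      then show False using large[of "\<bar>t\<bar>"] by (simp add: z')
    qed
    then show "\<i> * complex_of_real t \<in> {z \<in> cball 0 T. mittag_leffler \<alpha> 1 z = 0}"
      using z by (simp add: norm_mult)
  qed
  ultimately have "finite ((\<lambda>t. \<i> * complex_of_real t) ` {t. mittag_leffler \<alpha> 1 (\<i> * of_real t) = 0})"
    by (rule finite_subset[rotated])
  then show ?thesis
    by (rule finite_imageD) (auto simp: inj_on_def)
qed

lemma mittag_leffler_imaginary_nonzero:
  assumes \<alpha>: "0 < \<alpha>" "\<alpha> \<le> 3/5"
  shows "mittag_leffler \<alpha> 1 (\<i> * of_real t) \<noteq> 0"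
proof (cases "\<alpha> = 1/2 \<or> t = 0")
  case True
  then show ?thesis
  proof
    assume h: "\<alpha> = 1/2"
    show ?thesis
    proof
      assume "mittag_leffler \<alpha> 1 (\<i> * of_real t) = 0"
      then have "Re (mittag_leffler (1/2) 1 (\<i> * of_real t)) = 0" by (simp add: h)
      then show False by (simp add: Re_mittag_leffler_half)
    qed
  qed (use mittag_leffler_0[OF \<alpha>(1)] in simp)
next
  case False
  \<comment> \<open>The substitution undoes \<open>y powr \<alpha>\<close>, so that every nonzero
    \<open>t\<close> is reached, up to sign, by the positivity lemma.\<close>
  define y where "y = \<bar>t\<bar> powr (1/\<alpha>)"
  have "Im (mittag_leffler \<alpha> 1 (\<i> * of_real (y powr \<alpha>))) > 0"
    using False \<alpha> by (intro Im_mittag_leffler_pos) (auto simp: y_def)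
  moreover have "y powr \<alpha> = \<bar>t\<bar>" using \<alpha> by (simp add: y_def powr_powr)
  ultimately show ?thesis
    using mittag_leffler_imaginary_abs[OF \<alpha>(1), of t] by auto
qed

theorem proposition2p5:
  fixes \<alpha> :: real
  shows "(\<alpha> \<in> {0<..3/5} \<longrightarrow> (\<forall>t::real. mittag_leffler \<alpha> 1 (\<i> * complex_of_real t) \<noteq> 0)) \<and>
    (\<alpha> \<in> {3/5<..<1} \<longrightarrow> finite {t::real. mittag_leffler \<alpha> 1 (\<i> * complex_of_real t) = 0})"
  using mittag_leffler_imaginary_nonzero[of \<alpha>] finite_mittag_leffler_imaginary_zeros[of \<alpha>] by auto

end
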